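(* Fix $\delta\in(0,1)$ with $\delta^{-1}\notin\mathbb N$, let $k=\lfloor n^\delta\rfloor$, and consider the Block Average process on $n$ sites with deterministic block size $X\equiv k$, started from the Dirac mass at a site $x_0$. For $\beta\ge0$ let $\bar t(\beta)=\lfloor\beta n/k\rfloor$, and define the random time $\tau_{\rm start}=\inf\{t\ge1:\ x_0\in A_t\}$. Then, for every $\beta\ge0$, as $n\to\infty$, $$d_{\rm TV}\big(\tau_{\rm start}+\bar t(\beta)\big)\longrightarrow\Pr\big(\tau_{\lfloor\delta^{-1}\rfloor}>\beta\big)\quad\text{in probability},$$ where $\tau_j$ denotes the $j$-th arrival time of a Poisson process of unit rate.
   Context: Let $V=\{1,\dots,n\}$ and let $\Delta$ be the set of probability vectors on $V$. For $A\subset V$ and $\eta\in\Delta$, let $\varPsi_A\eta(x)=\frac1{|A|}\sum_{y\in A}\eta(y)$ if $x\in A$ and $\varPsi_A\eta(x)=\eta(x)$ if $x\notin A$. The Block Average process with block size $k$ (with $n$ large enough that $k\ge2$) is $\eta_t=\varPsi_{A_t}\cdots\varPsi_{A_1}\eta_0$, where $A_1,A_2,\dots$ are independent uniformly random subsets of $V$ of cardinality $k$; here $\eta_0$ is the Dirac mass at $x_0\in V$. Let $\pi(x)\equiv 1/n$, $\|v\|_{\rm TV}=\frac12\sum_{x\in V}|v(x)|$, and $d_{\rm TV}(t)=\|\eta_t-\pi\|_{\rm TV}$ (a random variable). *)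

theory Defs
  imports "HOL-Probability.Probability"
begin

section \<open>The Block Average process\<close>

definition sites :: "nat \<Rightarrow> nat set" where
  "sites n = {1..n}"

definition blocks :: "nat \<Rightarrow> nat \<Rightarrow> nat set set" where
  "blocks n k = {S. S \<subseteq> sites n \<and> card S = k}"

text \<open>Vectors on the sites are functions on all of nat; only their values on
  \<open>sites n\<close> matter.\<close>

definition average_over :: "nat set \<Rightarrow> (nat \<Rightarrow> real) \<Rightarrow> nat \<Rightarrow> real" where
  "average_over S \<eta> x = (if x \<in> S then (\<Sum>y\<in>S. \<eta> y) / real (card S) else \<eta> x)"

definition dirac_vec :: "nat \<Rightarrow> nat \<Rightarrow> real" where
  "dirac_vec x\<^sub>0 x = (if x = x\<^sub>0 then 1 else 0)"

definition uniform_vec :: "nat \<Rightarrow> nat \<Rightarrow> real" where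
  "uniform_vec n x = 1 / real n"

definition tv_norm :: "nat \<Rightarrow> (nat \<Rightarrow> real) \<Rightarrow> real" where
  "tv_norm n v = (\<Sum>x\<in>sites n. \<bar>v x\<bar>) / 2"

text \<open>The chosen blocks are \<open>S 1\<close>, \<open>S 2\<close>, ...; the value \<open>S 0\<close> is not used.\<close>

primrec avg_state :: "nat \<Rightarrow> (nat \<Rightarrow> nat set) \<Rightarrow> nat \<Rightarrow> nat \<Rightarrow> real" where
  "avg_state x\<^sub>0 S 0 = dirac_vec x\<^sub>0"
| "avg_state x\<^sub>0 S (Suc t) = average_over (S (Suc t)) (avg_state x\<^sub>0 S t)"

definition tv_dist :: "nat \<Rightarrow> nat \<Rightarrow> (nat \<Rightarrow> nat set) \<Rightarrow> nat \<Rightarrow> real" where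
  "tv_dist n x\<^sub>0 S t = tv_norm n (\<lambda>x. avg_state x\<^sub>0 S t x - uniform_vec n x)"

text \<open>If \<open>x\<^sub>0\<close> is never chosen, the infimum is over the empty set and equals 0 by
  convention; for uniformly random nonempty blocks this is a null event.\<close>

definition start_time :: "nat \<Rightarrow> (nat \<Rightarrow> nat set) \<Rightarrow> nat" where
  "start_time x\<^sub>0 S = Inf {t. 1 \<le> t \<and> x\<^sub>0 \<in> S t}"

definition iid_uniform_blocks ::
    "'a measure \<Rightarrow> nat \<Rightarrow> nat \<Rightarrow> (nat \<Rightarrow> 'a \<Rightarrow> nat set) \<Rightarrow> bool" where
  "iid_uniform_blocks M n k A \<longleftrightarrow>
     prob_space M \<and>
     prob_space.indep_vars M (\<lambda>_. count_space (blocks n k)) A {1..} \<and>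
     (\<forall>t\<ge>1. distr M (count_space (blocks n k)) (A t) = uniform_count_measure (blocks n k))"


section \<open>Poisson processes\<close>

definition poisson_process :: "'b measure \<Rightarrow> real \<Rightarrow> (real \<Rightarrow> 'b \<Rightarrow> nat) \<Rightarrow> bool" where
  "poisson_process P r N \<longleftrightarrow>
     prob_space P \<and> 0 < r \<and>
     (\<forall>t\<ge>0. N t \<in> measurable P (count_space UNIV)) \<and>
     (\<forall>\<omega>\<in>space P. N 0 \<omega> = 0 \<and>
        mono_on {0..} (\<lambda>t. N t \<omega>) \<and>
        (\<forall>t\<ge>0. continuous (at_right t) (\<lambda>s. N s \<omega>))) \<and>
     (\<forall>m u. 0 \<le> u 0 \<and> (\<forall>i<m. u i \<le> u (Suc i)) \<longrightarrow>
        prob_space.indep_vars P (\<lambda>_. count_space UNIV)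
          (\<lambda>i \<omega>. N (u (Suc i)) \<omega> - N (u i) \<omega>) {..<m}) \<and>
     (\<forall>s t. 0 \<le> s \<and> s < t \<longrightarrow>
        distr P (count_space UNIV) (\<lambda>\<omega>. N t \<omega> - N s \<omega>) =
          measure_pmf (poisson_pmf (r * (t - s))))"

text \<open>The infimum is taken in the extended reals, so it is \<open>\<infinity>\<close> if there are fewer than
  \<open>j\<close> arrivals.\<close>

definition arrival_time :: "(real \<Rightarrow> 'b \<Rightarrow> nat) \<Rightarrow> nat \<Rightarrow> 'b \<Rightarrow> ereal" where
  "arrival_time N j \<omega> = Inf {ereal t | t. 0 \<le> t \<and> j \<le> N t \<omega>}"


section \<open>Convergence in probability to a constant\<close>

text \<open>The variables may live on different probability spaces.  Their measurability is part of
  the definition, since otherwise the deviation probabilities could be junk values.\<close>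

definition tendsto_in_probability ::
    "(nat \<Rightarrow> 'a measure) \<Rightarrow> (nat \<Rightarrow> 'a \<Rightarrow> real) \<Rightarrow> real \<Rightarrow> bool" where
  "tendsto_in_probability M X c \<longleftrightarrow>
     (\<forall>\<^sub>F n in sequentially. X n \<in> borel_measurable (M n)) \<and>
     (\<forall>\<epsilon>>0. (\<lambda>n. measure (M n) {\<omega> \<in> space (M n). \<epsilon> < \<bar>X n \<omega> - c\<bar>}) \<longlonglongrightarrow> 0)"

end

theory Submission
  imports Defs
begin

text \<open>
  Let \<open>m = \<lfloor>1 / \<delta>\<rfloor>\<close> and split the mass of the process according to how often it has been
  averaged after the first block that hits the starting site.  Mass averaged fewer than \<open>m\<close> times
  sits on \<open>O(k ^ m) = o(n)\<close> sites, hence is asymptotically singular to the uniform vector.  The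
  remaining mass is dominated by the uniform vector up to \<open>o(1)\<close>: it is the average, over a
  fresh block, of the mass averaged at least \<open>m - 1\<close> times, and such an average is close to its
  mean \<open>\<le> 1 / n\<close>, because the squared \<open>L\<^sup>2\<close> norm of that mass is \<open>O(1 / k ^ m + 1 / n)\<close> and
  \<open>k ^ (m + 1)\<close> is much larger than \<open>n\<close>.  So the distance is asymptotically the total mass averaged
  fewer than \<open>m\<close> times.  Its expectation is a binomial probability with a Poisson limit, and each
  step contributes variance at most \<open>1 / n\<close>, hence at most \<open>\<beta> / k\<close> in total.
\<close>


section \<open>Uniform means over finite sets\<close>

text \<open>Stands in for expectation under a uniform law. Division by zero makes it 0 on empty and
  infinite sets, so linearity needs no side conditions; \<open>prob_path\<close> links it to genuine
  probabilities.\<close>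

definition mean :: "'a set \<Rightarrow> ('a \<Rightarrow> real) \<Rightarrow> real" where
  "mean X f = (\<Sum>x\<in>X. f x) / real (card X)"

lemma mean_add: "mean X (\<lambda>x. f x + g x) = mean X f + mean X g"
  by (simp add: mean_def sum.distrib add_divide_distrib)

lemma mean_diff: "mean X (\<lambda>x. f x - g x) = mean X f - mean X g"
  by (simp add: mean_def sum_subtractf diff_divide_distrib)

lemma mean_cmult: "mean X (\<lambda>x. c * f x) = c * mean X f"
  by (simp add: mean_def sum_distrib_left)

lemma mean_divide: "mean X (\<lambda>x. f x / c) = mean X f / c"
  by (simp add: mean_def sum_divide_distrib divide_simps mult.commute)

lemma mean_const: "finite X \<Longrightarrow> X \<noteq> {} \<Longrightarrow> mean X (\<lambda>_. c) = c"
  by (simp add: mean_def)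

lemma mean_mono: "(\<And>x. x \<in> X \<Longrightarrow> f x \<le> g x) \<Longrightarrow> mean X f \<le> mean X g"
  by (simp add: mean_def divide_right_mono sum_mono)

lemma mean_cong: "(\<And>x. x \<in> X \<Longrightarrow> f x = g x) \<Longrightarrow> mean X f = mean X g"
  by (simp add: mean_def)

lemma mean_nonneg: "(\<And>x. x \<in> X \<Longrightarrow> 0 \<le> f x) \<Longrightarrow> 0 \<le> mean X f"
  by (simp add: mean_def sum_nonneg)

lemma mean_sum: "mean X (\<lambda>x. \<Sum>y\<in>Y. f x y) = (\<Sum>y\<in>Y. mean X (\<lambda>x. f x y))"
  unfolding mean_def by (subst sum.swap) (simp add: sum_divide_distrib)

lemma mean_multc: "mean X (\<lambda>x. f x * c) = mean X f * c"
  using mean_cmult[of X c f] by (simp add: mult.commute)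

text \<open>The variance of \<open>\<bar>f x\<bar>\<close> under the uniform law is nonnegative;
  expand it.\<close>

lemma mean_abs_le_sqrt:
  assumes "finite X" "X \<noteq> {}"
  shows "mean X (\<lambda>x. \<bar>f x\<bar>) \<le> sqrt (mean X (\<lambda>x. (f x)\<^sup>2))"
proof (rule real_le_rsqrt)
  define \<mu> where "\<mu> = mean X (\<lambda>x. \<bar>f x\<bar>)"
  have "0 \<le> mean X (\<lambda>x. (\<bar>f x\<bar> - \<mu>)\<^sup>2)"
    by (intro mean_nonneg) simp
  also have "\<dots> = mean X (\<lambda>x. ((f x)\<^sup>2 - (2 * \<mu>) * \<bar>f x\<bar>) + \<mu>\<^sup>2)"
    by (intro mean_cong) (simp add: power2_eq_square algebra_simps)
  also have "\<dots> = mean X (\<lambda>x. (f x)\<^sup>2) - \<mu>\<^sup>2"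
    using assms unfolding mean_add mean_diff mean_cmult mean_const[OF assms] \<mu>_def[symmetric]
    by (simp add: power2_eq_square)
  finally show "(mean X (\<lambda>x. \<bar>f x\<bar>))\<^sup>2 \<le> mean X (\<lambda>x. (f x)\<^sup>2)"
    by (simp add: \<mu>_def)
qed

lemma mean_markov:
  assumes "0 < \<epsilon>" "\<And>x. x \<in> X \<Longrightarrow> 0 \<le> f x"
  shows "mean X (\<lambda>x. of_bool (\<epsilon> < f x)) \<le> mean X f / \<epsilon>"
proof -
  have "mean X (\<lambda>x. of_bool (\<epsilon> < f x)) \<le> mean X (\<lambda>x. f x / \<epsilon>)"
    using assms by (intro mean_mono) (auto simp: field_simps of_bool_def)
  then show ?thesis by (simp add: mean_divide)
qed


section \<open>Sampling a uniform block\<close>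

lemma finite_sites [simp]: "finite (sites n)" and card_sites [simp]: "card (sites n) = n"
  by (simp_all add: sites_def)

lemma finite_blocks [simp]: "finite (blocks n k)"
  by (rule finite_subset[of _ "Pow (sites n)"]) (auto simp: blocks_def)

lemma card_blocks: "card (blocks n k) = n choose k"
  by (simp add: blocks_def n_subsets)

lemma blocks_nonempty: "k \<le> n \<Longrightarrow> blocks n k \<noteq> {}"
  using card_blocks[of n k] by (metis binomial_eq_0_iff card.empty not_less)

lemma blocksD:
  assumes "S \<in> blocks n k"
  shows "S \<subseteq> sites n" "card S = k" "finite S"
  using assms by (auto simp: blocks_def intro: finite_subset[OF _ finite_sites])

text \<open>Deleting \<open>F\<close> is a bijection onto the subsets of the complement of size
  \<open>k - card F\<close>.\<close>

lemma card_blocks_supersets: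
  assumes F: "F \<subseteq> sites n" "card F \<le> k"
  shows "card {S \<in> blocks n k. F \<subseteq> S} = (n - card F) choose (k - card F)"
proof -
  have finF: "finite F" using F finite_subset[OF _ finite_sites] by blast
  have "bij_betw (\<lambda>S. S - F) {S \<in> blocks n k. F \<subseteq> S}
          {S. S \<subseteq> sites n - F \<and> card S = k - card F}"
    by (rule bij_betw_byWitness[where f' = "\<lambda>S. S \<union> F"])
       (use F finF in \<open>auto simp: blocks_def card_Diff_subset Int_absorb2 Diff_triv
          intro!: card_Un_disjoint[THEN trans] intro: finite_subset[OF _ finite_sites]\<close>)
  then have "card {S \<in> blocks n k. F \<subseteq> S} = card (sites n - F) choose (k - card F)"
    by (simp add: bij_betw_same_card n_subsets)
  then show ?thesis using F finF by (simp add: card_Diff_subset)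
qed

section \<open>Inclusion probabilities and the first two moments of block sums\<close>

locale sampling =
  fixes n k :: nat
  assumes two_le_k: "2 \<le> k" and k_le_n: "k \<le> n"
begin

abbreviation "rate \<equiv> real k / real n"

lemma pos [simp]: "0 < k" "0 < n" "0 < real k" "0 < real n" "k \<noteq> 0" "n \<noteq> 0"
  using two_le_k k_le_n by auto

lemma rate_bounds: "0 \<le> rate" "rate \<le> 1"
  using k_le_n by (auto simp: field_simps)

lemma card_blocks_pos: "0 < real (card (blocks n k))"
  using k_le_n by (simp add: card_blocks)

lemma block_mean_const [simp]: "mean (blocks n k) (\<lambda>_. c) = c"
  using blocks_nonempty[OF k_le_n] by (simp add: mean_const)

lemma prob_mem: "x \<in> sites n \<Longrightarrow> mean (blocks n k) (\<lambda>S. of_bool (x \<in> S)) = rate"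
proof -
  assume x: "x \<in> sites n"
  have "card {S \<in> blocks n k. x \<in> S} = (n - 1) choose (k - 1)"
    using card_blocks_supersets[of "{x}" n k] x two_le_k by simp
  moreover have "real k * real (n choose k) = real n * real ((n - 1) choose (k - 1))"
    using times_binomial_minus1_eq[of k n] by (metis of_nat_mult pos(1))
  ultimately show ?thesis
    using card_blocks_pos
    by (simp add: mean_def of_bool_def card_blocks sum.If_cases Int_def field_simps)
qed

text \<open>The probability that two distinct sites both fall into a uniform block. It is at most
  \<open>rate\<^sup>2\<close> because sampling without replacement is negatively correlated.\<close>

definition pair_rate :: real where
  "pair_rate = (real k * (real k - 1)) / (real n * (real n - 1))"

lemma pair_rate_bounds: "0 \<le> pair_rate" "pair_rate \<le> rate\<^sup>2"
proof -
  show "0 \<le> pair_rate" using two_le_k k_le_n by (simp add: pair_rate_def)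
  have "(real k - 1) / (real n - 1) \<le> rate"
    using two_le_k k_le_n by (simp add: field_simps)
  then have "rate * ((real k - 1) / (real n - 1)) \<le> rate * rate"
    using rate_bounds by (intro mult_left_mono) auto
  then show "pair_rate \<le> rate\<^sup>2" by (simp add: pair_rate_def power2_eq_square)
qed

lemma prob_mem2:
  assumes "x \<in> sites n" "y \<in> sites n" "x \<noteq> y"
  shows "mean (blocks n k) (\<lambda>S. of_bool (x \<in> S) * of_bool (y \<in> S)) = pair_rate"
proof -
  have "card {S \<in> blocks n k. x \<in> S \<and> y \<in> S} = (n - 2) choose (k - 2)"
    using card_blocks_supersets[of "{x, y}" n k] assms two_le_k by (simp add: numeral_2_eq_2)
  \<comment> \<open>The absorption identity for binomials, here at \<open>n\<close>,
    \<open>k\<close> and next at \<open>n - 1\<close>, \<open>k - 1\<close>.\<close>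
  moreover have "real k * real (n choose k) = real n * real ((n - 1) choose (k - 1))"
    using times_binomial_minus1_eq[of k n] by (metis of_nat_mult pos(1))
  moreover have "real (k - 1) * real ((n - 1) choose (k - 1)) =
      real (n - 1) * real ((n - 1 - 1) choose (k - 1 - 1))"
    using times_binomial_minus1_eq[of "k - 1" "n - 1"] two_le_k
    by (metis of_nat_mult Suc_1 Suc_le_lessD zero_less_diff)
  then have "(real k - 1) * real ((n - 1) choose (k - 1)) =
      (real n - 1) * real ((n - 2) choose (k - 2))"
    using two_le_k k_le_n by (simp add: numeral_2_eq_2 of_nat_diff)
  ultimately have *: "real k * (real k - 1) * real (n choose k) =
      real n * (real n - 1) * real (card {S \<in> blocks n k. x \<in> S \<and> y \<in> S})"
    by (metis mult.assoc mult.left_commute)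
  have "mean (blocks n k) (\<lambda>S. of_bool (x \<in> S) * of_bool (y \<in> S)) =
      real (card {S \<in> blocks n k. x \<in> S \<and> y \<in> S}) / real (n choose k)"
    unfolding mean_def of_bool_conj[symmetric]
    by (simp add: of_bool_def card_blocks sum.If_cases Int_def)
  also have "\<dots> = pair_rate"
    using * card_blocks_pos two_le_k k_le_n
    by (simp add: pair_rate_def card_blocks divide_eq_eq eq_divide_eq field_simps)
  finally show ?thesis .
qed

lemma block_sum: "S \<in> blocks n k \<Longrightarrow> (\<Sum>x\<in>S. f x) = (\<Sum>x\<in>sites n. of_bool (x \<in> S) * (f x :: real))"
  by (simp add: sum.If_cases of_bool_def if_distrib[of "\<lambda>c. c * _"] Int_absorb1 blocksD(1) cong: if_cong)

lemma block_mean_sum: "mean (blocks n k) (\<lambda>S. \<Sum>x\<in>S. f x) = rate * (\<Sum>x\<in>sites n. f x)"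
proof -
  have "mean (blocks n k) (\<lambda>S. \<Sum>x\<in>S. f x) =
      mean (blocks n k) (\<lambda>S. \<Sum>x\<in>sites n. of_bool (x \<in> S) * f x)"
    by (intro mean_cong block_sum)
  also have "\<dots> = (\<Sum>x\<in>sites n. rate * f x)"
    unfolding mean_sum mean_multc by (intro sum.cong refl) (simp only: prob_mem)
  finally show ?thesis by (simp add: sum_distrib_left)
qed

text \<open>Expand the square into pairs of sites: diagonal pairs have probability
  \<open>rate\<close>, all others \<open>pair_rate\<close>, which is at most
  \<open>rate\<^sup>2\<close>. Only squares remain at the end, so \<open>f\<close> may have any
  sign.\<close>

lemma block_mean_sum_square:
  "mean (blocks n k) (\<lambda>S. (\<Sum>x\<in>S. f x)\<^sup>2) \<le>
     rate * (\<Sum>x\<in>sites n. (f x)\<^sup>2) + (rate * (\<Sum>x\<in>sites n. f x))\<^sup>2"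
proof -
  have "mean (blocks n k) (\<lambda>S. (\<Sum>x\<in>S. f x)\<^sup>2) =
      mean (blocks n k) (\<lambda>S. \<Sum>x\<in>sites n. \<Sum>y\<in>sites n.
        (of_bool (x \<in> S) * of_bool (y \<in> S)) * (f x * f y))"
    by (intro mean_cong) (simp only: block_sum power2_eq_square sum_product ac_simps)
  also have "\<dots> = (\<Sum>x\<in>sites n. \<Sum>y\<in>sites n.
      mean (blocks n k) (\<lambda>S. of_bool (x \<in> S) * of_bool (y \<in> S)) * (f x * f y))"
    by (simp only: mean_sum mean_multc)
  \<comment> \<open>Extending \<open>pair_rate\<close> to the diagonal completes the square of the
    sum; the \<open>if\<close> term corrects the diagonal.\<close>
  also have "\<dots> = (\<Sum>x\<in>sites n. \<Sum>y\<in>sites n.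
      pair_rate * (f x * f y) + (if y = x then (rate - pair_rate) * (f x)\<^sup>2 else 0))"
  proof (intro sum.cong refl)
    fix x y assume xy: "x \<in> sites n" "y \<in> sites n"
    show "mean (blocks n k) (\<lambda>S. of_bool (x \<in> S) * of_bool (y \<in> S)) * (f x * f y) =
        pair_rate * (f x * f y) + (if y = x then (rate - pair_rate) * (f x)\<^sup>2 else 0)"
    proof (cases "y = x")
      case True
      then show ?thesis using prob_mem[OF xy(1)]
        by (simp add: power2_eq_square algebra_simps flip: of_bool_conj)
    qed (use xy prob_mem2[of x y] in auto)
  qed
  also have "\<dots> = pair_rate * (\<Sum>x\<in>sites n. f x)\<^sup>2 + (rate - pair_rate) * (\<Sum>x\<in>sites n. (f x)\<^sup>2)"
    unfolding power2_eq_square[of "sum f _"] sum_product unfolding sum_distrib_left sum.distrib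
    by simp
  also have "\<dots> \<le> rate\<^sup>2 * (\<Sum>x\<in>sites n. f x)\<^sup>2 + rate * (\<Sum>x\<in>sites n. (f x)\<^sup>2)"
    using pair_rate_bounds by (intro add_mono mult_right_mono) (auto simp: sum_nonneg)
  finally show ?thesis by (simp only: power_mult_distrib add.commute)
qed

lemma block_variance:
  "mean (blocks n k) (\<lambda>S. ((\<Sum>x\<in>S. f x) - rate * (\<Sum>x\<in>sites n. f x))\<^sup>2) \<le>
     rate * (\<Sum>x\<in>sites n. (f x)\<^sup>2)"
proof -
  define \<mu> where "\<mu> = rate * (\<Sum>x\<in>sites n. f x)"
  have "mean (blocks n k) (\<lambda>S. ((\<Sum>x\<in>S. f x) - \<mu>)\<^sup>2) =
      mean (blocks n k) (\<lambda>S. ((\<Sum>x\<in>S. f x)\<^sup>2 - (2 * \<mu>) * (\<Sum>x\<in>S. f x)) + \<mu>\<^sup>2)"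
    by (intro mean_cong) (simp add: power2_eq_square algebra_simps)
  also have "\<dots> = mean (blocks n k) (\<lambda>S. (\<Sum>x\<in>S. f x)\<^sup>2) - \<mu>\<^sup>2"
    unfolding mean_add mean_diff mean_cmult block_mean_const block_mean_sum \<mu>_def[symmetric]
    by (simp add: power2_eq_square)
  finally show ?thesis using block_mean_sum_square[of f] by (simp add: \<mu>_def)
qed

end


section \<open>Mass averaged at least j times\<close>

text \<open>State right after the first block \<open>S\<close> that hits the starting site: the unit
  mass is uniform on \<open>S\<close> and none of it has been averaged again, so higher levels are
  empty.\<close>

definition level_init :: "nat set \<Rightarrow> nat \<Rightarrow> nat \<Rightarrow> real" where
  "level_init S j x = of_bool (j = 0 \<and> x \<in> S) / real (card S)"

text \<open>\<open>G j x\<close> is the mass at \<open>x\<close> that has been averaged at least \<open>j\<close> times after the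
  first block.  Truncated subtraction makes \<open>G 0\<close> evolve by plain averaging, so \<open>G 0\<close> is the whole process.\<close>

definition level_step :: "nat set \<Rightarrow> (nat \<Rightarrow> nat \<Rightarrow> real) \<Rightarrow> nat \<Rightarrow> nat \<Rightarrow> real" where
  "level_step S G j x = (if x \<in> S then (\<Sum>y\<in>S. G (j - 1) y) / real (card S) else G j x)"

definition levels :: "nat set \<Rightarrow> nat set list \<Rightarrow> nat \<Rightarrow> nat \<Rightarrow> real" where
  "levels S\<^sub>0 l = foldl (\<lambda>G S. level_step S G) (level_init S\<^sub>0) l"

lemma levels_Nil [simp]: "levels S\<^sub>0 [] = level_init S\<^sub>0"
  and levels_snoc [simp]: "levels S\<^sub>0 (l @ [S]) = level_step S (levels S\<^sub>0 l)"
  by (simp_all add: levels_def)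

lemma levels_nonneg: "0 \<le> levels S\<^sub>0 l j x"
  by (induction l arbitrary: j x rule: rev_induct)
     (auto simp: level_init_def level_step_def intro!: divide_nonneg_nonneg sum_nonneg)

lemma levels_Suc_le: "levels S\<^sub>0 l (Suc j) x \<le> levels S\<^sub>0 l j x"
proof (induction l arbitrary: j x rule: rev_induct)
  case (snoc S l)
  \<comment> \<open>Inside \<open>S\<close>, levels \<open>Suc j\<close> and \<open>j\<close> are
    refilled from levels \<open>j\<close> and \<open>j - 1\<close>, so the hypothesis is used one
    level lower; for \<open>j = 0\<close> both sides agree.\<close>
  have "levels S\<^sub>0 l j y \<le> levels S\<^sub>0 l (j - 1) y" for y
    using snoc[of "j - 1" y] by (cases j) auto
  then show ?case
    using snoc by (auto simp: level_step_def intro!: divide_right_mono sum_mono)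
qed (simp add: level_init_def)

lemma levels_pred: "levels S\<^sub>0 l j x \<le> levels S\<^sub>0 l (j - 1) x"
  using levels_Suc_le[of S\<^sub>0 l "j - 1" x] by (cases j) auto

lemma levels_le_0: "levels S\<^sub>0 l j x \<le> levels S\<^sub>0 l 0 x"
  by (induction j) (auto intro: order_trans[OF levels_Suc_le])

text \<open>The probability that a binomial variable with parameters \<open>t\<close> and
  \<open>p\<close> is at least \<open>j\<close>, by conditioning on one trial; the truncated
  \<open>j - 1\<close> keeps the value 1 at \<open>j = 0\<close>.\<close>

fun tail_prob :: "real \<Rightarrow> nat \<Rightarrow> nat \<Rightarrow> real" where
  "tail_prob p 0 j = of_bool (j = 0)"
| "tail_prob p (Suc t) j = (1 - p) * tail_prob p t j + p * tail_prob p t (j - 1)"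

text \<open>The recursion that \<open>energy_le\<close> produces: \<open>\<beta>\<close> bounds
  \<open>t * rate\<close>, the mean number of hits of a site in \<open>t\<close> steps, and the
  summand 1 accounts for fresh coincidences.\<close>

fun energy_const :: "real \<Rightarrow> nat \<Rightarrow> real" where
  "energy_const \<beta> 0 = 1"
| "energy_const \<beta> (Suc j) = \<beta> * (energy_const \<beta> j + 1)"

lemma energy_const_nonneg: "0 \<le> \<beta> \<Longrightarrow> 0 \<le> energy_const \<beta> j"
  by (induction j) auto

text \<open>The recursion that \<open>light_le\<close> produces: 1 for the initial block, and
  \<open>\<beta>\<close> times the previous constant for blocks that hit a light site of the level
  below.\<close>

fun light_const :: "real \<Rightarrow> nat \<Rightarrow> real" where
  "light_const \<beta> 0 = 0"
| "light_const \<beta> (Suc j) = 1 + \<beta> * light_const \<beta> j"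

lemma light_const_nonneg: "0 \<le> \<beta> \<Longrightarrow> 0 \<le> light_const \<beta> j"
  by (induction j) auto

section \<open>Uniform sequences of blocks\<close>

context sampling
begin

definition block_seqs :: "nat \<Rightarrow> nat set list set" where
  "block_seqs t = {l. set l \<subseteq> blocks n k \<and> length l = t}"

lemma finite_block_seqs [simp]: "finite (block_seqs t)"
  and card_block_seqs: "card (block_seqs t) = card (blocks n k) ^ t"
  by (simp_all add: block_seqs_def finite_lists_length_eq card_lists_length_eq)

lemma block_seqs_nonempty [simp]: "block_seqs t \<noteq> {}"
  using card_block_seqs[of t] card_blocks_pos by auto

lemma mean_block_seqs_const [simp]: "mean (block_seqs t) (\<lambda>_. c) = c"
  by (simp add: mean_const)

lemma block_seqs_0: "block_seqs 0 = {[]}"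
  by (auto simp: block_seqs_def)

lemma sum_block_seqs_append:
  "(\<Sum>l\<in>block_seqs (s + t). f l) = (\<Sum>l\<in>block_seqs s. \<Sum>l'\<in>block_seqs t. f (l @ l'))"
proof -
  have inj: "inj_on (\<lambda>(l, l'). l @ l') (block_seqs s \<times> block_seqs t)"
    by (auto simp: inj_on_def block_seqs_def)
  have eq: "block_seqs (s + t) = (\<lambda>(l, l'). l @ l') ` (block_seqs s \<times> block_seqs t)"
  proof (intro equalityI subsetI)
    fix l assume "l \<in> block_seqs (s + t)"
    then have "take s l \<in> block_seqs s" "drop s l \<in> block_seqs t"
      by (auto simp: block_seqs_def dest!: in_set_takeD in_set_dropD)
    then show "l \<in> (\<lambda>(l, l'). l @ l') ` (block_seqs s \<times> block_seqs t)"
      by (intro image_eqI[of _ _ "(take s l, drop s l)"]) auto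
  qed (auto simp: block_seqs_def)
  show ?thesis
    unfolding eq sum.reindex[OF inj] sum.cartesian_product by (simp add: case_prod_beta)
qed

lemma sum_block_seqs_1: "(\<Sum>l\<in>block_seqs (Suc 0). f l) = (\<Sum>S\<in>blocks n k. f [S])"
proof -
  have "block_seqs (Suc 0) = (\<lambda>S. [S]) ` blocks n k"
    by (auto simp: block_seqs_def length_Suc_conv)
  then show ?thesis by (simp add: sum.reindex inj_on_def)
qed

text \<open>Conditioning on the first \<open>t\<close> blocks: the inductions for mass, energy,
  excess and light sites average over the newest block first.\<close>

lemma mean_block_seqs_Suc:
  "mean (block_seqs (Suc t)) f = mean (block_seqs t) (\<lambda>l. mean (blocks n k) (\<lambda>S. f (l @ [S])))"
  using sum_block_seqs_append[of f t "Suc 0"]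
  by (simp add: mean_def sum_block_seqs_1 card_block_seqs sum_divide_distrib mult.commute)

text \<open>A step changes only the \<open>k\<close> values on \<open>S\<close>, which become equal.
  The free function \<open>h\<close> is later the identity for mass, the square for energy and a
  positive part for excess.\<close>

lemma sum_level_step:
  assumes S: "S \<in> blocks n k"
  shows "(\<Sum>x\<in>sites n. h (level_step S G j x)) =
    (\<Sum>x\<in>sites n. h (G j x)) - (\<Sum>x\<in>S. h (G j x)) + real k * h ((\<Sum>y\<in>S. G (j - 1) y) / real k)"
proof -
  have split: "(\<Sum>x\<in>sites n. f x) = (\<Sum>x\<in>sites n - S. f x) + (\<Sum>x\<in>S. f x)" for f :: "nat \<Rightarrow> real"
    by (simp add: sum.subset_diff[OF blocksD(1)[OF S]])
  show ?thesis
    using blocksD[OF S] by (simp add: split level_step_def)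
qed

end

section \<open>Mass of each level for a fixed first block \<open>S\<^sub>0\<close>\<close>

locale started_sampling = sampling +
  fixes S\<^sub>0
  assumes S0: "S\<^sub>0 \<in> blocks n k"
begin

abbreviation "G \<equiv> levels S\<^sub>0"

definition mass :: "nat set list \<Rightarrow> nat \<Rightarrow> real" where
  "mass l j = (\<Sum>x\<in>sites n. G l j x)"

lemma level_init_simp: "level_init S\<^sub>0 j x = of_bool (j = 0 \<and> x \<in> S\<^sub>0) / real k"
  by (simp add: level_init_def blocksD(2)[OF S0])

lemma sum_init: "(\<Sum>x\<in>sites n. of_bool (x \<in> S\<^sub>0) * c) = real k * (c :: real)"
  using block_sum[OF S0, of "\<lambda>_. c"] blocksD[OF S0] by (simp add: Int_absorb1)

lemma mass_Nil: "mass [] j = of_bool (j = 0)"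
  using sum_init[of "1 / real k"] by (cases "j = 0") (auto simp: mass_def level_init_simp)

text \<open>For \<open>j > 0\<close> the added sum is the mass in \<open>S\<close> averaged exactly
  \<open>j - 1\<close> times, which this block promotes to level \<open>j\<close>; for
  \<open>j = 0\<close> it vanishes, whence conservation of mass in \<open>mass_0\<close>.\<close>

lemma mass_snoc:
  assumes "S \<in> blocks n k"
  shows "mass (l @ [S]) j = mass l j + (\<Sum>x\<in>S. G l (j - 1) x - G l j x)"
  using sum_level_step[OF assms, where h = "\<lambda>x. x"] by (simp add: mass_def sum_subtractf)

lemma mass_0: "set l \<subseteq> blocks n k \<Longrightarrow> mass l 0 = 1"
  by (induction l rule: rev_induct) (simp_all add: mass_Nil mass_snoc)

lemma mass_nonneg: "0 \<le> mass l j"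
  by (simp add: mass_def levels_nonneg sum_nonneg)

lemma mass_le_1: "set l \<subseteq> blocks n k \<Longrightarrow> mass l j \<le> 1"
  using sum_mono[of "sites n" "G l j" "G l 0"] mass_0[of l] by (simp add: mass_def levels_le_0)

text \<open>By Cauchy-Schwarz on the block, averaging does not increase the sum of squares, and the
  start has exactly \<open>1 / k\<close>.\<close>

lemma sum_square_le:
  assumes "set l \<subseteq> blocks n k"
  shows "(\<Sum>x\<in>sites n. (G l 0 x)\<^sup>2) \<le> 1 / real k"
  using assms
proof (induction l rule: rev_induct)
  case Nil
  show ?case using sum_init[of "1 / (real k)\<^sup>2"]
    by (simp add: level_init_simp power_divide power2_eq_square flip: of_bool_conj)
next
  case (snoc S l)
  then have S: "S \<in> blocks n k" by simp
  have "(\<Sum>x\<in>S. G l 0 x)\<^sup>2 \<le> (\<Sum>x\<in>S. (G l 0 x)\<^sup>2) * real k"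
    using sum_squared_le_sum_of_squares[of "G l 0" S] blocksD(2)[OF S] by simp
  then have "real k * ((\<Sum>x\<in>S. G l 0 x) / real k)\<^sup>2 \<le> (\<Sum>x\<in>S. (G l 0 x)\<^sup>2)"
    by (simp add: power_divide power2_eq_square field_simps)
  then show ?case
    using snoc by (simp add: sum_level_step[OF S, where h = "\<lambda>x. x\<^sup>2"])
qed

text \<open>\<open>tail_prob\<close> obeys the recursion of the conditional mean of the mass, so
  this is a variance. A step mixes the old errors of levels \<open>j\<close> and
  \<open>j - 1\<close> and adds a centred fluctuation of second moment at most
  \<open>1 / n\<close>.\<close>

lemma mass_deviation:
  "mean (block_seqs t) (\<lambda>l. (mass l j - tail_prob rate t j)\<^sup>2) \<le> real t / real n"
proof (induction t arbitrary: j)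
  case 0
  show ?case by (simp add: block_seqs_0 mean_def mass_Nil)
next
  case (Suc t)
  define e where "e l j = mass l j - tail_prob rate t j" for l j
  have step: "mean (blocks n k) (\<lambda>S. (mass (l @ [S]) j - tail_prob rate (Suc t) j)\<^sup>2) \<le>
      (1 - rate) * (e l j)\<^sup>2 + rate * (e l (j - 1))\<^sup>2 + 1 / real n"
    if l: "l \<in> block_seqs t" for l
  proof -
    \<comment> \<open>\<open>f\<close> is the mass ready to enter level \<open>j\<close>,
      \<open>a\<close> the conditional mean of the new error, and \<open>\<xi>\<close> its centred
      fluctuation.\<close>
    define f where "f x = G l (j - 1) x - G l j x" for x
    define a where "a = (1 - rate) * e l j + rate * e l (j - 1)"
    define \<xi> where "\<xi> S = (\<Sum>x\<in>S. f x) - rate * (\<Sum>x\<in>sites n. f x)" for S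
    have lB: "set l \<subseteq> blocks n k" using l by (simp add: block_seqs_def)
    have sf: "(\<Sum>x\<in>sites n. f x) = mass l (j - 1) - mass l j"
      by (simp add: f_def mass_def sum_subtractf)
    have "mass (l @ [S]) j - tail_prob rate (Suc t) j = a + \<xi> S" if "S \<in> blocks n k" for S
      unfolding mass_snoc[OF that] f_def[symmetric] a_def \<xi>_def sf e_def
      by (simp add: algebra_simps)
    then have "mean (blocks n k) (\<lambda>S. (mass (l @ [S]) j - tail_prob rate (Suc t) j)\<^sup>2) =
        mean (blocks n k) (\<lambda>S. a\<^sup>2 + (2 * a) * \<xi> S + (\<xi> S)\<^sup>2)"
      by (intro mean_cong) (simp add: power2_eq_square algebra_simps)
    also have "\<dots> = a\<^sup>2 + 2 * a * mean (blocks n k) \<xi> + mean (blocks n k) (\<lambda>S. (\<xi> S)\<^sup>2)"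
      by (simp add: mean_add mean_cmult)
    also have "mean (blocks n k) \<xi> = 0"
      unfolding \<xi>_def mean_diff block_mean_sum block_mean_const by simp
    finally have eq: "mean (blocks n k) (\<lambda>S. (mass (l @ [S]) j - tail_prob rate (Suc t) j)\<^sup>2) =
        a\<^sup>2 + mean (blocks n k) (\<lambda>S. (\<xi> S)\<^sup>2)"
      by simp
    have "mean (blocks n k) (\<lambda>S. (\<xi> S)\<^sup>2) \<le> rate * (\<Sum>x\<in>sites n. (f x)\<^sup>2)"
      unfolding \<xi>_def by (rule block_variance)
    \<comment> \<open>Since \<open>0 \<le> f x \<le> G l 0 x\<close>, the energy of \<open>f\<close>
      is at most \<open>1 / k\<close>, and \<open>rate / k\<close> is \<open>1 / n\<close>.\<close>
    also have "\<dots> \<le> rate * (\<Sum>x\<in>sites n. (G l 0 x)\<^sup>2)"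
    proof (intro mult_left_mono sum_mono power_mono)
      fix x
      show "0 \<le> f x" using levels_pred by (simp add: f_def)
      show "f x \<le> G l 0 x"
        using levels_nonneg[of S\<^sub>0 l j x] levels_le_0[of S\<^sub>0 l "j - 1" x] by (simp add: f_def)
    qed (use rate_bounds in auto)
    also have "\<dots> \<le> rate * (1 / real k)"
      using sum_square_le[OF lB] rate_bounds by (intro mult_left_mono) auto
    finally have var: "mean (blocks n k) (\<lambda>S. (\<xi> S)\<^sup>2) \<le> 1 / real n" by simp
    \<comment> \<open>Convexity of the square made explicit: mixing the two old errors does not
      amplify their mean squares.\<close>
    have "(1 - rate) * (e l j)\<^sup>2 + rate * (e l (j - 1))\<^sup>2 - a\<^sup>2 =
        rate * (1 - rate) * (e l j - e l (j - 1))\<^sup>2"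
      unfolding a_def by algebra
    also have "\<dots> \<ge> 0" using rate_bounds by simp
    finally show ?thesis using var eq by linarith
  qed
  have "mean (block_seqs (Suc t)) (\<lambda>l. (mass l j - tail_prob rate (Suc t) j)\<^sup>2) \<le>
      mean (block_seqs t) (\<lambda>l. (1 - rate) * (e l j)\<^sup>2 + rate * (e l (j - 1))\<^sup>2 + 1 / real n)"
    unfolding mean_block_seqs_Suc by (intro mean_mono step)
  also have "\<dots> = (1 - rate) * mean (block_seqs t) (\<lambda>l. (e l j)\<^sup>2) +
      rate * mean (block_seqs t) (\<lambda>l. (e l (j - 1))\<^sup>2) + 1 / real n"
    unfolding mean_add mean_cmult by simp
  also have "\<dots> \<le> (1 - rate) * (real t / real n) + rate * (real t / real n) + 1 / real n"
    unfolding e_def using rate_bounds by (intro add_mono mult_left_mono Suc.IH order_refl) auto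
  also have "\<dots> = real (Suc t) / real n"
    by (simp add: field_simps)
  finally show ?case .
qed

section \<open>Energy: the sum of squares of a level\<close>

abbreviation "energy_bound \<beta> j \<equiv> energy_const \<beta> j * (1 / real k ^ Suc j + 1 / real n)"

text \<open>The energy of level \<open>j\<close> is of order \<open>1 / k ^ (j + 1) + 1 / n\<close>: a pair of particles
  meets either because it has always been together or by a fresh coincidence.\<close>

lemma energy_le:
  assumes "0 \<le> \<beta>" "real t * rate \<le> \<beta>"
  shows "mean (block_seqs t) (\<lambda>l. \<Sum>x\<in>sites n. (G l j x)\<^sup>2) \<le> energy_bound \<beta> j"
  using assms(2)
proof (induction j arbitrary: t)
  case 0
  have "mean (block_seqs t) (\<lambda>l. \<Sum>x\<in>sites n. (G l 0 x)\<^sup>2) \<le> mean (block_seqs t) (\<lambda>l. 1 / real k)"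
    by (intro mean_mono sum_square_le) (simp add: block_seqs_def)
  then show ?case by (auto intro: order_trans)
next
  case (Suc j)
  define e where "e = energy_bound \<beta> j"
  \<comment> \<open>One step adds at most this much mean energy: \<open>1 / k\<close> times the
    second moment of the level-\<open>j\<close> block sum, which
    \<open>block_mean_sum_square\<close> bounds by \<open>rate * e + rate\<^sup>2\<close>.\<close>
  define K where "K = (1 / real n) * e + real k / (real n)\<^sup>2"
  have e0: "0 \<le> e" using energy_const_nonneg[OF assms(1)] by (simp add: e_def)
  \<comment> \<open>The induction over time stays at \<open>s \<le> t\<close>, where the
    level-\<open>j\<close> bound applies; it starts from zero because level \<open>Suc j\<close> is
    initially empty.\<close>
  have "mean (block_seqs s) (\<lambda>l. \<Sum>x\<in>sites n. (G l (Suc j) x)\<^sup>2) \<le> real s * K"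
    if "s \<le> t" for s using that
  proof (induction s)
    case 0
    show ?case by (simp add: block_seqs_0 mean_def level_init_def)
  next
    case (Suc s)
    have "real s * rate \<le> real t * rate"
      using Suc.prems rate_bounds by (intro mult_right_mono) auto
    then have IH: "mean (block_seqs s) (\<lambda>l. \<Sum>x\<in>sites n. (G l j x)\<^sup>2) \<le> e"
      unfolding e_def
      using Suc.prems \<open>real t * rate \<le> \<beta>\<close> by (intro \<open>\<And>t. real t * rate \<le> \<beta> \<Longrightarrow> _ t\<close>) linarith
    have step: "mean (blocks n k) (\<lambda>S. \<Sum>x\<in>sites n. (G (l @ [S]) (Suc j) x)\<^sup>2) \<le>
        (\<Sum>x\<in>sites n. (G l (Suc j) x)\<^sup>2) + (1 / real n) * (\<Sum>x\<in>sites n. (G l j x)\<^sup>2)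
          + real k / (real n)\<^sup>2"
      if l: "l \<in> block_seqs s" for l
    proof -
      have lB: "set l \<subseteq> blocks n k" using l by (simp add: block_seqs_def)
      have "mean (blocks n k) (\<lambda>S. \<Sum>x\<in>sites n. (G (l @ [S]) (Suc j) x)\<^sup>2) \<le>
          mean (blocks n k) (\<lambda>S. (\<Sum>x\<in>sites n. (G l (Suc j) x)\<^sup>2)
            + (1 / real k) * (\<Sum>x\<in>S. G l j x)\<^sup>2)"
      proof (intro mean_mono)
        fix S assume S: "S \<in> blocks n k"
        have "real k * (y / real k)\<^sup>2 = (1 / real k) * y\<^sup>2" for y :: real
          by (simp add: power2_eq_square)
        \<comment> \<open>The old squares on \<open>S\<close> are discarded, which only enlarges the
          bound.\<close>
        then show "(\<Sum>x\<in>sites n. (G (l @ [S]) (Suc j) x)\<^sup>2) \<le>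
            (\<Sum>x\<in>sites n. (G l (Suc j) x)\<^sup>2) + (1 / real k) * (\<Sum>x\<in>S. G l j x)\<^sup>2"
          unfolding levels_snoc sum_level_step[OF S, where h = "\<lambda>x. x\<^sup>2"]
          by (simp add: sum_nonneg)
      qed
      also have "\<dots> = (\<Sum>x\<in>sites n. (G l (Suc j) x)\<^sup>2) +
          (1 / real k) * mean (blocks n k) (\<lambda>S. (\<Sum>x\<in>S. G l j x)\<^sup>2)"
        unfolding mean_add mean_cmult by simp
      also have "\<dots> \<le> (\<Sum>x\<in>sites n. (G l (Suc j) x)\<^sup>2) +
          (1 / real k) * (rate * (\<Sum>x\<in>sites n. (G l j x)\<^sup>2) + (rate * 1)\<^sup>2)"
        using block_mean_sum_square[of "G l j"] mass_le_1[OF lB, of j] mass_nonneg[of l j] rate_bounds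
        by (intro add_left_mono mult_left_mono order_trans[OF block_mean_sum_square] power_mono)
           (auto simp: mass_def simp del: times_divide_eq_left)
      finally show ?thesis by (simp add: power2_eq_square algebra_simps)
    qed
    have "mean (block_seqs (Suc s)) (\<lambda>l. \<Sum>x\<in>sites n. (G l (Suc j) x)\<^sup>2) \<le>
        mean (block_seqs s) (\<lambda>l. (\<Sum>x\<in>sites n. (G l (Suc j) x)\<^sup>2)
          + (1 / real n) * (\<Sum>x\<in>sites n. (G l j x)\<^sup>2) + real k / (real n)\<^sup>2)"
      unfolding mean_block_seqs_Suc by (intro mean_mono step)
    also have "\<dots> \<le> real s * K + (1 / real n) * e + real k / (real n)\<^sup>2"
      unfolding mean_add mean_cmult mean_block_seqs_const
      using Suc by (intro add_mono mult_left_mono IH) auto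
    finally show ?case by (simp add: K_def algebra_simps add_divide_distrib)
  qed
  then have "mean (block_seqs t) (\<lambda>l. \<Sum>x\<in>sites n. (G l (Suc j) x)\<^sup>2) \<le> real t * K" by simp
  also have "\<dots> = (real t * rate) * (e / real k + 1 / real n)"
    by (simp add: K_def field_simps power2_eq_square)
  also have "\<dots> \<le> \<beta> * (e / real k + 1 / real n)"
    using Suc.prems e0 by (intro mult_right_mono) auto
  \<comment> \<open>The summands are the decayed energy \<open>e / k\<close> and the fresh
    coincidences \<open>1 / n\<close>; both are enlarged to multiples of one common factor.\<close>
  also have "\<dots> \<le> \<beta> * (energy_const \<beta> j * (1 / real k ^ Suc (Suc j) + 1 / real n)
      + (1 / real k ^ Suc (Suc j) + 1 / real n))"
  proof (intro mult_left_mono add_mono assms(1))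
    have "e / real k = energy_const \<beta> j * (1 / real k ^ Suc (Suc j) + 1 / real n / real k)"
      by (simp add: e_def field_simps)
    also have "\<dots> \<le> energy_const \<beta> j * (1 / real k ^ Suc (Suc j) + 1 / real n)"
      using two_le_k energy_const_nonneg[OF assms(1), of j]
      by (intro mult_left_mono add_mono) (auto simp: field_simps)
    finally show "e / real k \<le> energy_const \<beta> j * (1 / real k ^ Suc (Suc j) + 1 / real n)" .
  qed simp
  finally show ?case by (simp add: algebra_simps add_divide_distrib)
qed

section \<open>Excess of a level over the uniform vector\<close>

definition excess :: "nat set list \<Rightarrow> nat \<Rightarrow> real" where
  "excess l j = (\<Sum>x\<in>sites n. max 0 (G l j x - 1 / real n))"

text \<open>On a block, level \<open>Suc j\<close> becomes the block average of level
  \<open>j\<close>, whose mean is at most \<open>1 / n\<close> since that level has mass at most 1.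
  Excess thus arises only from fluctuations of the block sum, controlled by the energy of level
  \<open>j\<close>.\<close>

lemma excess_le:
  assumes "0 \<le> \<beta>" "real t * rate \<le> \<beta>"
  shows "mean (block_seqs t) (\<lambda>l. excess l (Suc j)) \<le> real t * sqrt (rate * energy_bound \<beta> j)"
  using assms(2)
proof (induction t)
  case 0
  show ?case by (simp add: block_seqs_0 mean_def excess_def level_init_def)
next
  case (Suc t)
  have "real t * rate \<le> real (Suc t) * rate"
    using rate_bounds by (intro mult_right_mono) auto
  then have t: "real t * rate \<le> \<beta>" using Suc.prems by linarith
  \<comment> \<open>Written through \<open>last\<close> and \<open>butlast\<close> so that
    \<open>\<xi>\<close> is a function of the whole sequence and one use of
    \<open>mean_abs_le_sqrt\<close> covers both averages.\<close>
  define \<xi> where "\<xi> l = (\<Sum>x\<in>last l. G (butlast l) j x) - rate * mass (butlast l) j" for l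
  have step: "excess (l @ [S]) (Suc j) \<le> excess l (Suc j) + \<bar>\<xi> (l @ [S])\<bar>"
    if l: "l \<in> block_seqs t" and S: "S \<in> blocks n k" for l S
  proof -
    have lB: "set l \<subseteq> blocks n k" using l by (simp add: block_seqs_def)
    have "rate * mass l j \<le> rate * 1"
      using mass_le_1[OF lB] rate_bounds by (intro mult_left_mono) auto
    \<comment> \<open>Multiplying by \<open>k\<close> turns the threshold \<open>1 / n\<close> into
      \<open>rate\<close>, which is at least the mean \<open>rate * mass l j\<close>.\<close>
    then have "real k * max 0 ((\<Sum>x\<in>S. G l j x) / real k - 1 / real n) \<le> \<bar>\<xi> (l @ [S])\<bar>"
      by (auto simp: \<xi>_def max_def right_diff_distrib)
    then show ?thesis
      using sum_nonneg[of S "\<lambda>x. max 0 (G l (Suc j) x - 1 / real n)"]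
      by (simp add: excess_def sum_level_step[OF S, where h = "\<lambda>x. max 0 (x - 1 / real n)"])
  qed
  have "mean (block_seqs (Suc t)) (\<lambda>l. excess l (Suc j)) \<le>
      mean (block_seqs t) (\<lambda>l. mean (blocks n k) (\<lambda>S. excess l (Suc j) + \<bar>\<xi> (l @ [S])\<bar>))"
    unfolding mean_block_seqs_Suc by (intro mean_mono step)
  also have "\<dots> = mean (block_seqs t) (\<lambda>l. excess l (Suc j)) + mean (block_seqs (Suc t)) (\<lambda>l. \<bar>\<xi> l\<bar>)"
    unfolding mean_block_seqs_Suc mean_add by simp
  also have "mean (block_seqs (Suc t)) (\<lambda>l. \<bar>\<xi> l\<bar>) \<le> sqrt (mean (block_seqs (Suc t)) (\<lambda>l. (\<xi> l)\<^sup>2))"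
    by (rule mean_abs_le_sqrt) auto
  also have "mean (block_seqs (Suc t)) (\<lambda>l. (\<xi> l)\<^sup>2) \<le>
      mean (block_seqs t) (\<lambda>l. rate * (\<Sum>x\<in>sites n. (G l j x)\<^sup>2))"
    unfolding mean_block_seqs_Suc
    by (intro mean_mono) (simp only: \<xi>_def last_snoc butlast_snoc mass_def block_variance)
  also have "\<dots> \<le> rate * energy_bound \<beta> j"
    unfolding mean_cmult using rate_bounds by (intro mult_left_mono energy_le assms(1) t)
  finally show ?case using Suc.IH[OF t] by (simp add: algebra_simps)
qed

section \<open>Sites carrying mass averaged fewer than \<open>j\<close> times\<close>

definition light :: "nat set list \<Rightarrow> nat \<Rightarrow> nat set" where
  "light l j = {x \<in> sites n. G l j x \<noteq> G l 0 x}"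

text \<open>A block disjoint from \<open>light l j\<close> averages equal values for levels
  \<open>j\<close> and \<open>0\<close>, so it creates no light site one level up. Otherwise it
  creates at most \<open>k\<close>, a cost charged to each light site it meets.\<close>

lemma light_snoc:
  assumes S: "S \<in> blocks n k"
  shows "real (card (light (l @ [S]) (Suc j))) \<le>
    real (card (light l (Suc j))) + real k * (\<Sum>x\<in>S. of_bool (x \<in> light l j))"
proof (cases "S \<inter> light l j = {}")
  case True
  then have "G l j x = G l 0 x" if "x \<in> S" for x
    using that blocksD(1)[OF S] by (auto simp: light_def)
  then have "light (l @ [S]) (Suc j) \<subseteq> light l (Suc j)"
    by (auto simp: light_def level_step_def)
  then have "card (light (l @ [S]) (Suc j)) \<le> card (light l (Suc j))"
    by (intro card_mono) (auto simp: light_def)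
  then show ?thesis by (simp add: sum_nonneg add_increasing2)
next
  case False
  have "light (l @ [S]) (Suc j) \<subseteq> light l (Suc j) \<union> S"
    by (auto simp: light_def level_step_def)
  then have "card (light (l @ [S]) (Suc j)) \<le> card (light l (Suc j) \<union> S)"
    using blocksD(3)[OF S] by (intro card_mono) (auto simp: light_def)
  also have "\<dots> \<le> card (light l (Suc j)) + k"
    using card_Un_le[of "light l (Suc j)" S] blocksD(2)[OF S] by simp
  finally have *: "real (card (light (l @ [S]) (Suc j))) \<le> real (card (light l (Suc j))) + real k"
    by linarith
  obtain x where x: "x \<in> S" "x \<in> light l j" using False by blast
  have "1 \<le> (\<Sum>x\<in>S. of_bool (x \<in> light l j) :: real)"
    using member_le_sum[OF x(1), of "\<lambda>x. of_bool (x \<in> light l j) :: real"] x blocksD(3)[OF S] by simp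
  then have "real k * 1 \<le> real k * (\<Sum>x\<in>S. of_bool (x \<in> light l j))"
    by (intro mult_left_mono) auto
  then show ?thesis using * by linarith
qed

text \<open>Level 0 has no light sites. Level \<open>Suc j\<close> starts with at most
  \<open>k\<close>; then a step meets on average \<open>rate * card (light l j)\<close> light sites
  of the level below, each costing \<open>k\<close>.\<close>

lemma light_le:
  assumes "0 \<le> \<beta>" "real t * rate \<le> \<beta>"
  shows "mean (block_seqs t) (\<lambda>l. real (card (light l j))) \<le> light_const \<beta> j * real k ^ j"
  using assms(2)
proof (induction j arbitrary: t)
  case 0
  show ?case by (simp add: light_def mean_def)
next
  case (Suc j)
  define K where "K = light_const \<beta> j * real k ^ j"
  have K0: "0 \<le> K" using light_const_nonneg[OF assms(1)] by (simp add: K_def)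
  have "mean (block_seqs s) (\<lambda>l. real (card (light l (Suc j)))) \<le> real k + real s * (real k * rate * K)"
    if "s \<le> t" for s using that
  proof (induction s)
    case 0
    have "light [] (Suc j) \<subseteq> S\<^sub>0" by (auto simp: light_def level_init_def)
    then have "card (light [] (Suc j)) \<le> k"
      using blocksD[OF S0] card_mono by metis
    then show ?case by (simp add: block_seqs_0 mean_def)
  next
    case (Suc s)
    have "real s * rate \<le> real t * rate"
      using Suc.prems rate_bounds by (intro mult_right_mono) auto
    then have IH: "mean (block_seqs s) (\<lambda>l. real (card (light l j))) \<le> K"
      unfolding K_def
      using Suc.prems \<open>real t * rate \<le> \<beta>\<close> by (intro \<open>\<And>t. real t * rate \<le> \<beta> \<Longrightarrow> _ t\<close>) linarith
    have step: "mean (blocks n k) (\<lambda>S. real (card (light (l @ [S]) (Suc j)))) \<le>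
        real (card (light l (Suc j))) + (real k * rate) * real (card (light l j))" for l
    proof -
      have "mean (blocks n k) (\<lambda>S. real (card (light (l @ [S]) (Suc j)))) \<le>
          mean (blocks n k) (\<lambda>S. real (card (light l (Suc j)))
            + real k * (\<Sum>x\<in>S. of_bool (x \<in> light l j)))"
        by (intro mean_mono light_snoc)
      also have "\<dots> = real (card (light l (Suc j))) + real k * (rate * (\<Sum>x\<in>sites n. of_bool (x \<in> light l j)))"
        unfolding mean_add mean_cmult block_mean_sum by simp
      also have "(\<Sum>x\<in>sites n. of_bool (x \<in> light l j) :: real) = real (card (light l j))"
        by (auto simp: of_bool_def sum.If_cases light_def intro!: arg_cong[where f = card])
      finally show ?thesis by simp
    qed
    have "mean (block_seqs (Suc s)) (\<lambda>l. real (card (light l (Suc j)))) \<le>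
        mean (block_seqs s) (\<lambda>l. real (card (light l (Suc j))) + (real k * rate) * real (card (light l j)))"
      unfolding mean_block_seqs_Suc by (intro mean_mono step)
    also have "\<dots> \<le> (real k + real s * (real k * rate * K)) + (real k * rate) * K"
      unfolding mean_add mean_cmult using Suc rate_bounds by (intro add_mono mult_left_mono IH) auto
    finally show ?case by (simp add: algebra_simps add_divide_distrib)
  qed
  then have "mean (block_seqs t) (\<lambda>l. real (card (light l (Suc j)))) \<le>
      real k + (real t * rate) * (real k * K)"
    by (fastforce simp: algebra_simps)
  also have "\<dots> \<le> real k * real k ^ j + \<beta> * (real k * K)"
    using Suc.prems K0 two_le_k by (intro add_mono mult_right_mono) (auto simp: self_le_power)
  finally show ?case by (simp add: K_def algebra_simps add_divide_distrib)
qed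

end


section \<open>Distance to the uniform vector through the levels\<close>

definition error_bound :: "nat \<Rightarrow> nat \<Rightarrow> real \<Rightarrow> nat \<Rightarrow> nat \<Rightarrow> real" where
  "error_bound n k \<beta> t j = sqrt (real t / real n)
     + real t * sqrt (real k / real n * (energy_const \<beta> j * (1 / real k ^ Suc j + 1 / real n)))
     + light_const \<beta> (Suc j) * real k ^ Suc j / real n"

context started_sampling
begin

abbreviation tv :: "nat set list \<Rightarrow> real" where
  "tv l \<equiv> tv_norm n (\<lambda>x. levels S\<^sub>0 l 0 x - uniform_vec n x)"

text \<open>The distance is the sum of the positive parts of \<open>G l 0 x - 1 / n\<close>. From
  above, it is at most the excess of level \<open>j\<close> plus all remaining mass
  \<open>1 - mass l j\<close>. From below, this remaining mass sits on light sites, and each of them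
  loses at most \<open>1 / n\<close>.\<close>

lemma tv_approx:
  assumes l: "set l \<subseteq> blocks n k"
  shows "\<bar>tv l - (1 - mass l j)\<bar> \<le> excess l j + real (card (light l j)) / real n"
proof -
  define D where "D = (\<Sum>x\<in>sites n. max 0 (G l 0 x - 1 / real n))"
  \<comment> \<open>The identity \<open>\<bar>v\<bar> = 2 * max 0 v - v\<close>; its linear part
    sums to zero since both vectors have total mass 1.\<close>
  have "(\<Sum>x\<in>sites n. \<bar>G l 0 x - 1 / real n\<bar>) =
      (\<Sum>x\<in>sites n. 2 * max 0 (G l 0 x - 1 / real n) - (G l 0 x - 1 / real n))"
    by (intro sum.cong) (auto simp: max_def)
  also have "\<dots> = 2 * D - (mass l 0 - 1)"
    by (simp add: D_def mass_def sum_subtractf sum_distrib_left)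
  finally have tv: "tv l = D"
    by (simp add: tv_norm_def uniform_vec_def mass_0[OF l])
  have "D \<le> (\<Sum>x\<in>sites n. (G l 0 x - G l j x) + max 0 (G l j x - 1 / real n))"
    unfolding D_def using levels_le_0[of S\<^sub>0 l j] by (intro sum_mono) (auto simp: max_def)
  then have upper: "D \<le> (1 - mass l j) + excess l j"
    using mass_0[OF l] by (simp add: sum.distrib sum_subtractf mass_def excess_def)
  have "(\<Sum>x\<in>sites n. (G l 0 x - G l j x) - of_bool (x \<in> light l j) * (1 / real n)) \<le> D"
    unfolding D_def
  proof (intro sum_mono)
    fix x assume "x \<in> sites n"
    then show "(G l 0 x - G l j x) - of_bool (x \<in> light l j) * (1 / real n) \<le> max 0 (G l 0 x - 1 / real n)"
      using levels_nonneg[of S\<^sub>0 l j x] by (cases "x \<in> light l j") (auto simp: max_def light_def)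
  qed
  moreover have "(\<Sum>x\<in>sites n. of_bool (x \<in> light l j) * (1 / real n)) = real (card (light l j)) / real n"
    unfolding sum_distrib_right[symmetric]
    by (auto simp: of_bool_def sum.If_cases light_def intro!: arg_cong[where f = card])
  ultimately have lower: "(1 - mass l j) - real (card (light l j)) / real n \<le> D"
    using mass_0[OF l] by (simp add: sum_subtractf mass_def)
  have "0 \<le> excess l j" by (simp add: excess_def sum_nonneg)
  then show ?thesis
    using upper lower divide_nonneg_nonneg[of "real (card (light l j))" "real n"]
    unfolding tv abs_le_iff by linarith
qed

text \<open>Half of \<open>\<epsilon>\<close> absorbs the deterministic gap between the binomial
  probability and \<open>c\<close>; Markov's inequality for the random error \<open>Z\<close> uses
  the other half.\<close>

lemma tv_deviation:
  assumes "0 \<le> \<beta>" "real t * rate \<le> \<beta>" "0 < \<epsilon>"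
    and c: "\<bar>(1 - tail_prob rate t (Suc j)) - c\<bar> \<le> \<epsilon> / 2"
  shows "mean (block_seqs t) (\<lambda>l. of_bool (\<epsilon> < \<bar>tv l - c\<bar>)) \<le> error_bound n k \<beta> t j / (\<epsilon> / 2)"
proof -
  define Z where "Z l = \<bar>mass l (Suc j) - tail_prob rate t (Suc j)\<bar> + excess l (Suc j)
    + real (card (light l (Suc j))) / real n" for l
  have Z0: "0 \<le> Z l" for l by (simp add: Z_def excess_def sum_nonneg)
  have "mean (block_seqs t) (\<lambda>l. of_bool (\<epsilon> < \<bar>tv l - c\<bar>)) \<le>
      mean (block_seqs t) (\<lambda>l. of_bool (\<epsilon> / 2 < Z l))"
  proof (intro mean_mono)
    fix l assume "l \<in> block_seqs t"
    then have "\<bar>tv l - (1 - mass l (Suc j))\<bar> \<le> excess l (Suc j) + real (card (light l (Suc j))) / real n"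
      by (intro tv_approx) (simp add: block_seqs_def)
    then have "\<bar>tv l - c\<bar> \<le> Z l + \<epsilon> / 2"
      using c unfolding Z_def by linarith
    then show "of_bool (\<epsilon> < \<bar>tv l - c\<bar>) \<le> (of_bool (\<epsilon> / 2 < Z l) :: real)"
      by (auto simp: of_bool_def)
  qed
  also have "\<dots> \<le> mean (block_seqs t) Z / (\<epsilon> / 2)"
    using assms(3) Z0 by (intro mean_markov) auto
  also have "mean (block_seqs t) Z \<le> error_bound n k \<beta> t j"
  proof -
    have "mean (block_seqs t) (\<lambda>l. \<bar>mass l (Suc j) - tail_prob rate t (Suc j)\<bar>) \<le>
        sqrt (mean (block_seqs t) (\<lambda>l. (mass l (Suc j) - tail_prob rate t (Suc j))\<^sup>2))"
      by (intro mean_abs_le_sqrt) auto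
    also have "\<dots> \<le> sqrt (real t / real n)"
      by (intro real_sqrt_le_mono mass_deviation)
    finally show ?thesis
      \<comment> \<open>The summands of \<open>error_bound\<close> match those of \<open>Z\<close>
        in order: fluctuation of the mass, excess, and proportion of light sites.\<close>
      unfolding Z_def mean_add mean_divide error_bound_def
      using light_le[OF assms(1,2), of "Suc j"]
      by (intro add_mono excess_le assms divide_right_mono) auto
  qed
  finally show ?thesis using assms(3) by (simp add: divide_right_mono)
qed

end


section \<open>The process before and after the first hit\<close>

lemma avg_state_cong:
  "(\<And>i. 1 \<le> i \<Longrightarrow> i \<le> t \<Longrightarrow> S i = S' i) \<Longrightarrow> avg_state x\<^sub>0 S t = avg_state x\<^sub>0 S' t"
  by (induction t) auto

lemma avg_state_before:
  "(\<And>i. 1 \<le> i \<Longrightarrow> i \<le> t \<Longrightarrow> x\<^sub>0 \<notin> S i) \<Longrightarrow> avg_state x\<^sub>0 S t = dirac_vec x\<^sub>0"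
proof (induction t)
  case (Suc t)
  have "x\<^sub>0 \<notin> S (Suc t)" using Suc.prems by auto
  then have "(\<Sum>y\<in>S (Suc t). dirac_vec x\<^sub>0 y) = 0"
    by (intro sum.neutral) (auto simp: dirac_vec_def)
  then show ?case
    using Suc \<open>x\<^sub>0 \<notin> S (Suc t)\<close> by (auto simp: average_over_def dirac_vec_def fun_eq_iff)
qed simp

text \<open>After the first hit, plain averaging coincides with level 0. The hit occurs at time
  \<open>Suc r\<close>, so the remaining \<open>t\<close> blocks carry the times
  \<open>Suc (Suc r)\<close> to \<open>Suc r + t\<close>.\<close>

lemma avg_state_after:
  assumes "\<And>i. 1 \<le> i \<Longrightarrow> i \<le> r \<Longrightarrow> x\<^sub>0 \<notin> S i" "x\<^sub>0 \<in> S (Suc r)" "finite (S (Suc r))"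
  shows "avg_state x\<^sub>0 S (Suc r + t) = levels (S (Suc r)) (map S [Suc (Suc r)..<Suc (Suc r) + t]) 0"
proof (induction t)
  case 0
  have "(\<Sum>y\<in>S (Suc r). dirac_vec x\<^sub>0 y) = 1"
    using assms(2,3) by (simp add: dirac_vec_def)
  then show ?case
    using assms(2) avg_state_before[of r x\<^sub>0 S, OF assms(1)]
    by (auto simp: average_over_def level_init_def dirac_vec_def fun_eq_iff)
next
  case (Suc t)
  then show ?case
    by (auto simp: average_over_def level_step_def fun_eq_iff)
qed

lemma start_time_eq:
  assumes "\<And>i. 1 \<le> i \<Longrightarrow> i \<le> r \<Longrightarrow> x\<^sub>0 \<notin> S i" "x\<^sub>0 \<in> S (Suc r)"
  shows "start_time x\<^sub>0 S = Suc r"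
  unfolding start_time_def Inf_nat_def
  by (rule Least_equality) (use assms in \<open>auto simp: not_less_eq_eq[symmetric]\<close>)

section \<open>Splitting block sequences and avoiding a site\<close>

context sampling
begin

lemma mean_block_seqs_append:
  "mean (block_seqs (s + t)) f = mean (block_seqs s) (\<lambda>l. mean (block_seqs t) (\<lambda>l'. f (l @ l')))"
  by (simp add: mean_def sum_block_seqs_append card_block_seqs sum_divide_distrib power_add mult.commute)

lemma mean_block_seqs_Cons:
  "mean (block_seqs (Suc t)) f = mean (blocks n k) (\<lambda>S. mean (block_seqs t) (\<lambda>l. f (S # l)))"
  using mean_block_seqs_append[of "Suc 0" t f]
  by (simp add: mean_def[of "block_seqs (Suc 0)"] mean_def[of "blocks n k"] sum_block_seqs_1 card_block_seqs)

lemma prob_avoid: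
  assumes "x \<in> sites n"
  shows "mean (block_seqs t) (\<lambda>l. of_bool (\<forall>S\<in>set l. x \<notin> S)) = (1 - rate) ^ t"
proof (induction t)
  case 0
  show ?case by (simp add: block_seqs_0 mean_def)
next
  case (Suc t)
  have "mean (block_seqs (Suc t)) (\<lambda>l. of_bool (\<forall>S\<in>set l. x \<notin> S)) =
      mean (blocks n k) (\<lambda>S. mean (block_seqs t) (\<lambda>l. of_bool (\<forall>S\<in>set l. x \<notin> S)) * (1 - of_bool (x \<in> S)))"
    unfolding mean_block_seqs_Cons by (intro mean_cong) (simp add: mean_def)
  also have "\<dots> = (1 - rate) ^ t * (1 - rate)"
    unfolding mean_cmult mean_diff Suc using prob_mem[OF assms] by simp
  finally show ?case by simp
qed

end

section \<open>Independent random blocks on a probability space\<close>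

locale iid_sampling = sampling +
  fixes M :: "'a measure" and A :: "nat \<Rightarrow> 'a \<Rightarrow> nat set" and x\<^sub>0 :: nat
  assumes iid: "iid_uniform_blocks M n k A" and x0: "x\<^sub>0 \<in> sites n"
begin

sublocale prob_space M
  using iid by (simp add: iid_uniform_blocks_def)

lemma indep: "indep_vars (\<lambda>_. count_space (blocks n k)) A {1..}"
  using iid by (simp add: iid_uniform_blocks_def)

lemma meas: "1 \<le> t \<Longrightarrow> A t \<in> measurable M (count_space (blocks n k))"
  using indep by (auto simp: indep_vars_def)

lemma A_in_blocks: "1 \<le> t \<Longrightarrow> \<omega> \<in> space M \<Longrightarrow> A t \<omega> \<in> blocks n k"
  using measurable_space[OF meas] by simp

definition path :: "nat \<Rightarrow> 'a \<Rightarrow> nat set list" where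
  "path t \<omega> = map (\<lambda>i. A i \<omega>) [1..<Suc t]"

lemma length_path [simp]: "length (path t \<omega>) = t"
  by (simp add: path_def del: upt_Suc)

lemma path_nth: "i < t \<Longrightarrow> path t \<omega> ! i = A (Suc i) \<omega>"
  by (simp add: path_def del: upt_Suc)

lemma path_in: "\<omega> \<in> space M \<Longrightarrow> path t \<omega> \<in> block_seqs t"
  using A_in_blocks by (auto simp: block_seqs_def path_def)

lemma path_eq_iff:
  assumes "length l = t"
  shows "path t \<omega> = l \<longleftrightarrow> (\<forall>i\<in>{1..t}. A i \<omega> = l ! (i - 1))"
proof -
  have "path t \<omega> = l \<longleftrightarrow> (\<forall>i<t. A (Suc i) \<omega> = l ! i)"
    using assms by (auto simp: list_eq_iff_nth_eq path_nth)
  also have "\<dots> \<longleftrightarrow> (\<forall>i\<in>{1..t}. A i \<omega> = l ! (i - 1))"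
  proof (intro iffI ballI allI impI)
    fix i assume *: "\<forall>i<t. A (Suc i) \<omega> = l ! i" "i \<in> {1..t}"
    then show "A i \<omega> = l ! (i - 1)" using *(1)[rule_format, of "i - 1"] by auto
  next
    fix i assume *: "\<forall>i\<in>{1..t}. A i \<omega> = l ! (i - 1)" "i < t"
    then show "A (Suc i) \<omega> = l ! i" using *(1)[rule_format, of "Suc i"] by auto
  qed
  finally show ?thesis .
qed

text \<open>Independence factors the probability of a given path into \<open>t\<close> equal
  factors, so the path is uniform on \<open>block_seqs t\<close>.\<close>

lemma path_event:
  assumes "l \<in> block_seqs t"
  shows "path t -` {l} \<inter> space M \<in> events"
    and "prob (path t -` {l} \<inter> space M) = 1 / real (card (block_seqs t))"
proof -
  have len: "length l = t" using assms by (simp add: block_seqs_def)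
  have lB: "l ! (i - 1) \<in> blocks n k" if "i \<in> {1..t}" for i
  proof -
    have "i - 1 < length l" using that len by auto
    then have "l ! (i - 1) \<in> set l" by (rule nth_mem)
    moreover have "set l \<subseteq> blocks n k" using assms by (simp add: block_seqs_def)
    ultimately show ?thesis by blast
  qed
  \<comment> \<open>An intersection over no times would be \<open>UNIV\<close> instead of
    \<open>space M\<close>, so \<open>t = 0\<close> is treated apart.\<close>
  have ev: "path t -` {l} \<inter> space M =
      (\<Inter>i\<in>{1..t}. A i -` {l ! (i - 1)} \<inter> space M)" if "t \<noteq> 0"
  proof -
    have "\<omega> \<in> path t -` {l} \<longleftrightarrow> (\<forall>i\<in>{1..t}. \<omega> \<in> A i -` {l ! (i - 1)})" for \<omega>
      unfolding vimage_singleton_eq path_eq_iff[OF len] ..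
    moreover have "{1..t} \<noteq> {}" using that by simp
    ultimately show ?thesis by auto
  qed
  have ev_meas: "A i -` {l ! (i - 1)} \<inter> space M \<in> events" if "i \<in> {1..t}" for i
    by (rule measurable_sets[OF meas]) (use that lB[OF that] in simp_all)
  have single: "prob (A i -` {l ! (i - 1)} \<inter> space M) = 1 / real (card (blocks n k))"
    if "i \<in> {1..t}" for i
  proof -
    have "prob (A i -` {l ! (i - 1)} \<inter> space M) =
        measure (distr M (count_space (blocks n k)) (A i)) {l ! (i - 1)}"
      using that lB[OF that] by (subst measure_distr[OF meas]) auto
    also have "\<dots> = measure (uniform_count_measure (blocks n k)) {l ! (i - 1)}"
      using iid that by (simp add: iid_uniform_blocks_def)
    also have "\<dots> = 1 / real (card (blocks n k))"
      using lB[OF that] by (simp add: measure_uniform_count_measure)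
    finally show ?thesis .
  qed
  show "path t -` {l} \<inter> space M \<in> events"
  proof (cases "t = 0")
    case True
    then have "path t -` {l} \<inter> space M = space M" using len by (auto simp: path_def)
    then show ?thesis by simp
  next
    case False
    then show ?thesis unfolding ev[OF False] using ev_meas False by (intro sets.finite_INT) auto
  qed
  show "prob (path t -` {l} \<inter> space M) = 1 / real (card (block_seqs t))"
  proof (cases "t = 0")
    case True
    then have "path t -` {l} \<inter> space M = space M" using len by (auto simp: path_def)
    then show ?thesis using True by (simp add: prob_space card_block_seqs)
  next
    case False
    have "prob (\<Inter>i\<in>{1..t}. A i -` {l ! (i - 1)} \<inter> space M) =
        (\<Prod>i\<in>{1..t}. prob (A i -` {l ! (i - 1)} \<inter> space M))"
      by (rule indep_varsD[OF indep]) (use False lB in auto)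
    also have "\<dots> = (\<Prod>i\<in>{1..t}. 1 / real (card (blocks n k)))"
      by (intro prod.cong refl single)
    finally show ?thesis
      unfolding ev[OF False] by (simp add: card_block_seqs power_one_over)
  qed
qed

lemma path_measurable: "path t \<in> measurable M (count_space (block_seqs t))"
  using path_in path_event(1) by (auto simp: measurable_count_space_eq2)

text \<open>The passage from the probability space to counting: an event of the first
  \<open>t\<close> blocks is a finite disjoint union of path events.\<close>

lemma prob_path: "prob {\<omega> \<in> space M. Q (path t \<omega>)} = mean (block_seqs t) (\<lambda>l. of_bool (Q l))"
proof -
  define R where "R = {l \<in> block_seqs t. Q l}"
  have "{\<omega> \<in> space M. Q (path t \<omega>)} = (\<Union>l\<in>R. path t -` {l} \<inter> space M)"
    using path_in by (auto simp: R_def)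
  also have "prob \<dots> = (\<Sum>l\<in>R. prob (path t -` {l} \<inter> space M))"
    by (rule finite_measure_finite_Union)
       (use path_event(1) in \<open>auto simp: R_def disjoint_family_on_def\<close>)
  also have "\<dots> = (\<Sum>l\<in>R. 1 / real (card (block_seqs t)))"
    by (intro sum.cong) (auto simp: R_def path_event(2))
  also have "\<dots> = mean (block_seqs t) (\<lambda>l. of_bool (Q l))"
    by (simp add: mean_def of_bool_def sum.If_cases R_def Int_def)
  finally show ?thesis .
qed

lemma path_event_Collect: "{\<omega> \<in> space M. Q (path t \<omega>)} \<in> events"
proof -
  have "{\<omega> \<in> space M. Q (path t \<omega>)} = path t -` {l \<in> block_seqs t. Q l} \<inter> space M"
    using path_in by auto
  then show ?thesis using measurable_sets[OF path_measurable, of "{l \<in> block_seqs t. Q l}"] by auto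
qed

lemma tv_dist_measurable: "(\<lambda>\<omega>. tv_dist n x\<^sub>0 (\<lambda>t. A t \<omega>) s) \<in> borel_measurable M"
proof -
  \<comment> \<open>The distance at a fixed time depends on finitely many blocks, so it factors
    through the discrete space of paths.\<close>
  define F where "F l = tv_dist n x\<^sub>0 (\<lambda>i. l ! (i - 1)) s" for l
  have "tv_dist n x\<^sub>0 (\<lambda>t. A t \<omega>) s = F (path s \<omega>)" for \<omega>
    unfolding tv_dist_def F_def
    by (subst avg_state_cong[of s "\<lambda>t. A t \<omega>" "\<lambda>i. path s \<omega> ! (i - 1)"]) (auto simp: path_nth)
  moreover have "(\<lambda>\<omega>. F (path s \<omega>)) \<in> borel_measurable M"
    by (rule measurable_compose[OF path_measurable]) simp
  ultimately show ?thesis by presburger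
qed

lemma start_time_measurable:
  "(\<lambda>\<omega>. start_time x\<^sub>0 (\<lambda>t. A t \<omega>)) \<in> measurable M (count_space UNIV)"
proof -
  have "Measurable.pred M (\<lambda>\<omega>. 1 \<le> t \<and> x\<^sub>0 \<in> A t \<omega>)" for t
  proof (cases "1 \<le> t")
    case True
    have "Measurable.pred M (\<lambda>\<omega>. x\<^sub>0 \<in> A t \<omega>)"
      by (rule measurable_compose[OF meas[OF True]]) simp
    then show ?thesis using True by simp
  qed simp
  then show ?thesis
    unfolding start_time_def Inf_nat_def mem_Collect_eq by (rule measurable_Least)
qed

lemma stopped_tv_dist_measurable:
  "(\<lambda>\<omega>. tv_dist n x\<^sub>0 (\<lambda>t. A t \<omega>) (start_time x\<^sub>0 (\<lambda>t. A t \<omega>) + T)) \<in> borel_measurable M"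
  by (rule measurable_compose_countable[OF tv_dist_measurable
        measurable_compose[OF start_time_measurable]]) simp

text \<open>The strong Markov property at the first hit: given the hitting time and block, the next
  \<open>T\<close> blocks are again uniform, so a bound uniform in the block survives summation over
  hitting times.\<close>

lemma stopped_prob_le:
  assumes bound: "\<And>S. S \<in> blocks n k \<Longrightarrow>
      mean (block_seqs T) (\<lambda>l. of_bool (B (tv_norm n (\<lambda>x. levels S l 0 x - uniform_vec n x)))) \<le> b"
  shows "prob {\<omega> \<in> space M. B (tv_dist n x\<^sub>0 (\<lambda>t. A t \<omega>) (start_time x\<^sub>0 (\<lambda>t. A t \<omega>) + T))} \<le> b"
proof -
  define bad where "bad S l \<longleftrightarrow> B (tv_norm n (\<lambda>x. levels S l 0 x - uniform_vec n x))" for S l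
  define avoid where "avoid l \<longleftrightarrow> (\<forall>S\<in>set l. x\<^sub>0 \<notin> S)" for l :: "nat set list"
  \<comment> \<open>The first \<open>r\<close> blocks miss the site, the block at list position
    \<open>r\<close> (time \<open>Suc r\<close>) hits it, and the next \<open>T\<close> blocks lead
    to the bad event.\<close>
  define Q where "Q r l \<longleftrightarrow> avoid (take r l) \<and> x\<^sub>0 \<in> l ! r \<and> bad (l ! r) (drop (Suc r) l)" for r l
  define E where "E r = {\<omega> \<in> space M. Q r (path (r + Suc T) \<omega>)}" for r
  define X where "X \<omega> = tv_dist n x\<^sub>0 (\<lambda>t. A t \<omega>) (start_time x\<^sub>0 (\<lambda>t. A t \<omega>) + T)" for \<omega>
  obtain S\<^sub>1 where "S\<^sub>1 \<in> blocks n k" using blocks_nonempty[OF k_le_n] by blast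
  then have b0: "0 \<le> b" by (rule order_trans[OF mean_nonneg bound, rotated]) simp
  have probE: "prob (E r) \<le> ((1 - rate) ^ r * rate) * b" for r
  proof -
    have "prob (E r) = mean (block_seqs r) (\<lambda>l\<^sub>1. mean (blocks n k) (\<lambda>S.
        mean (block_seqs T) (\<lambda>l\<^sub>2. of_bool (Q r (l\<^sub>1 @ S # l\<^sub>2)))))"
      unfolding E_def prob_path mean_block_seqs_append mean_block_seqs_Cons ..
    also have "\<dots> = mean (block_seqs r) (\<lambda>l\<^sub>1. of_bool (avoid l\<^sub>1) * mean (blocks n k) (\<lambda>S.
        of_bool (x\<^sub>0 \<in> S) * mean (block_seqs T) (\<lambda>l\<^sub>2. of_bool (bad S l\<^sub>2))))"
      unfolding mean_cmult[symmetric]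
      by (intro mean_cong) (auto simp: Q_def block_seqs_def nth_append)
    also have "\<dots> \<le> mean (block_seqs r) (\<lambda>l\<^sub>1. of_bool (avoid l\<^sub>1) * mean (blocks n k) (\<lambda>S.
        of_bool (x\<^sub>0 \<in> S) * b))"
      using bound unfolding bad_def by (intro mean_mono mult_left_mono) auto
    also have "\<dots> = ((1 - rate) ^ r * rate) * b"
      unfolding mean_multc avoid_def prob_avoid[OF x0] prob_mem[OF x0] by simp
    finally show ?thesis .
  qed
  have E_event: "E r \<in> events" for r
    unfolding E_def by (rule path_event_Collect)
  have avoid_event: "{\<omega> \<in> space M. avoid (path r \<omega>)} \<in> events" for r
    by (rule path_event_Collect)
  have UN_event: "(\<Union>r<R. E r) \<in> events" for R
    using E_event by (intro sets.finite_UN) auto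
  \<comment> \<open>Truncation at \<open>R\<close> leaves finitely many hitting times; a later hit
    costs \<open>(1 - rate) ^ R\<close>, which disappears as \<open>R\<close> grows.\<close>
  have le: "prob {\<omega> \<in> space M. B (X \<omega>)} \<le> (1 - rate) ^ R + b" for R
  proof -
    have "{\<omega> \<in> space M. B (X \<omega>)} \<subseteq> {\<omega> \<in> space M. avoid (path R \<omega>)} \<union> (\<Union>r<R. E r)"
    proof safe
      fix \<omega> assume \<omega>: "\<omega> \<in> space M" "B (X \<omega>)" "\<omega> \<notin> (\<Union>r<R. E r)"
      show "avoid (path R \<omega>)"
      proof (rule ccontr)
        assume "\<not> avoid (path R \<omega>)"
        then obtain i where i: "i < R" "x\<^sub>0 \<in> A (Suc i) \<omega>"
          by (auto simp: avoid_def in_set_conv_nth path_nth)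
        define r where "r = (LEAST r. x\<^sub>0 \<in> A (Suc r) \<omega>)"
        have r: "x\<^sub>0 \<in> A (Suc r) \<omega>" unfolding r_def using i(2) by (rule LeastI)
        have "r \<le> i" unfolding r_def using i(2) by (rule Least_le)
        have before: "x\<^sub>0 \<notin> A j \<omega>" if "1 \<le> j" "j \<le> r" for j
          using not_less_Least[of "j - 1" "\<lambda>r. x\<^sub>0 \<in> A (Suc r) \<omega>"] that
          by (auto simp: r_def[symmetric])
        have fin: "finite (A (Suc r) \<omega>)"
          using blocksD(3)[OF A_in_blocks[of "Suc r"]] \<omega>(1) by auto
        have take: "take r (path (r + Suc T) \<omega>) = path r \<omega>"
          by (simp add: path_def take_map del: upt_Suc)
        have drop: "drop (Suc r) (path (r + Suc T) \<omega>) =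
            map (\<lambda>i. A i \<omega>) [Suc (Suc r)..<Suc (Suc r) + T]"
          by (simp add: path_def drop_map del: upt_Suc)
        have "X \<omega> = tv_dist n x\<^sub>0 (\<lambda>t. A t \<omega>) (Suc r + T)"
          by (simp add: X_def start_time_eq[of r x\<^sub>0 "\<lambda>t. A t \<omega>", OF before r])
        also have "\<dots> = tv_norm n (\<lambda>x. levels (A (Suc r) \<omega>)
            (drop (Suc r) (path (r + Suc T) \<omega>)) 0 x - uniform_vec n x)"
          unfolding tv_dist_def drop
          using avg_state_after[of r x\<^sub>0 "\<lambda>t. A t \<omega>" T, OF before r fin] by simp
        finally have "bad (A (Suc r) \<omega>) (drop (Suc r) (path (r + Suc T) \<omega>))"
          using \<omega>(2) by (simp add: bad_def)
        moreover have "avoid (path r \<omega>)"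
          using before by (auto simp: avoid_def path_def)
        ultimately have "\<omega> \<in> E r"
          using \<omega>(1) r unfolding E_def mem_Collect_eq Q_def take by (simp add: path_nth)
        then show False using \<omega>(3) \<open>r \<le> i\<close> i(1) by auto
      qed
    qed
    then have "prob {\<omega> \<in> space M. B (X \<omega>)} \<le> prob ({\<omega> \<in> space M. avoid (path R \<omega>)} \<union> (\<Union>r<R. E r))"
      by (rule finite_measure_mono) (intro sets.Un avoid_event UN_event)
    also have "\<dots> \<le> prob {\<omega> \<in> space M. avoid (path R \<omega>)} + prob (\<Union>r<R. E r)"
      by (intro measure_Un_le avoid_event UN_event)
    also have "prob {\<omega> \<in> space M. avoid (path R \<omega>)} = (1 - rate) ^ R"
      unfolding prob_path unfolding avoid_def by (rule prob_avoid[OF x0])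
    also have "prob (\<Union>r<R. E r) \<le> (\<Sum>r<R. prob (E r))"
      by (intro finite_measure_subadditive_finite) (use E_event in auto)
    also have "\<dots> \<le> (\<Sum>r<R. ((1 - rate) ^ r * rate) * b)"
      by (intro sum_mono probE)
    also have "\<dots> = (1 - (1 - rate) ^ R) * b"
      using one_diff_power_eq[of "1 - rate" R] unfolding sum_distrib_right[symmetric]
      by (simp only: mult.commute diff_diff_eq2 add_diff_cancel_left')
    also have "\<dots> \<le> 1 * b"
      using b0 rate_bounds by (intro mult_right_mono) auto
    finally show ?thesis by simp
  qed
  have "(\<lambda>R. (1 - rate) ^ R + b) \<longlonglongrightarrow> 0 + b"
    using k_le_n by (intro tendsto_intros LIMSEQ_realpow_zero) (auto simp: field_simps)
  then have lim: "(\<lambda>R. (1 - rate) ^ R + b) \<longlonglongrightarrow> b" by simp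
  show ?thesis
    unfolding X_def[symmetric] by (rule LIMSEQ_le_const[OF lim]) (use le in auto)
qed

end


section \<open>Poisson limits\<close>

text \<open>The recursion of \<open>tail_prob\<close> is Pascal's rule for the binomial weights,
  summed below \<open>j\<close>.\<close>

lemma tail_prob_binomial:
  "1 - tail_prob p t j = (\<Sum>i<j. real (t choose i) * p ^ i * (1 - p) ^ (t - i))"
proof (induction t arbitrary: j)
  case 0
  have "(\<Sum>i<j. real (0 choose i) * p ^ i * (1 - p) ^ (0 - i)) = (\<Sum>i<j. if i = 0 then 1 else 0)"
    by (intro sum.cong) (auto simp: binomial_eq_0)
  then show ?case by auto
next
  case (Suc t)
  define b where "b t i = real (t choose i) * p ^ i * (1 - p) ^ (t - i)" for t i
  have b_Suc: "b (Suc t) (Suc i) = (1 - p) * b t (Suc i) + p * b t i" for i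
  \<comment> \<open>The exponent \<open>t - Suc i\<close> is truncated; beyond \<open>t\<close> the
    weight \<open>b t (Suc i)\<close> vanishes.\<close>
  proof (cases "Suc i \<le> t")
    case True
    then have pow: "(1 - p) ^ (t - i) = (1 - p) * (1 - p) ^ (t - Suc i)"
      by (simp add: Suc_diff_Suc flip: power_Suc)
    show ?thesis unfolding b_def diff_Suc_Suc pow by (simp add: algebra_simps)
  qed (simp add: b_def binomial_eq_0)
  have b_0: "b (Suc t) 0 = (1 - p) * b t 0" by (simp add: b_def)
  have IH: "tail_prob p t j = 1 - (\<Sum>i<j. b t i)" for j
    using Suc[of j] by (simp add: b_def)
  show ?case
  proof (cases j)
    case 0
    then show ?thesis using IH[of 0] by simp
  next
    case (Suc j')
    have "(\<Sum>i<j. b (Suc t) i) = (1 - p) * b t 0 + (\<Sum>i<j'. (1 - p) * b t (Suc i) + p * b t i)"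
      unfolding Suc sum.lessThan_Suc_shift b_Suc b_0 ..
    also have "\<dots> = (1 - p) * (\<Sum>i<j. b t i) + p * (\<Sum>i<j'. b t i)"
      unfolding Suc sum.lessThan_Suc_shift sum.distrib sum_distrib_left[symmetric]
      by (simp add: algebra_simps)
    finally have sum_eq: "(\<Sum>i<j. b (Suc t) i) = (1 - p) * (\<Sum>i<j. b t i) + p * (\<Sum>i<j'. b t i)" .
    show ?thesis
      unfolding b_def[symmetric] sum_eq tail_prob.simps IH by (simp add: Suc algebra_simps)
  qed
qed

text \<open>Squeeze from \<open>1 + x \<le> exp x\<close>, taken at \<open>x = - p n\<close> for the
  upper and at \<open>x = p n / (1 - p n)\<close> for the lower bound.\<close>

lemma power_one_minus_tendsto_exp:
  fixes p :: "nat \<Rightarrow> real"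
  assumes p: "p \<longlonglongrightarrow> 0" "\<And>n. 0 \<le> p n" and mp: "(\<lambda>n. real (m n) * p n) \<longlonglongrightarrow> \<beta>"
  shows "(\<lambda>n. (1 - p n) ^ m n) \<longlonglongrightarrow> exp (- \<beta>)"
proof (rule tendsto_sandwich)
  have lt: "\<forall>\<^sub>F n in sequentially. p n < 1"
    using order_tendstoD(2)[OF p(1), of 1] by simp
  show "\<forall>\<^sub>F n in sequentially. (1 - p n) ^ m n \<le> exp (- (real (m n) * p n))"
    using lt
  proof eventually_elim
    case (elim n)
    have "(1 - p n) ^ m n \<le> exp (- p n) ^ m n"
      using elim exp_ge_add_one_self[of "- p n"] by (intro power_mono) auto
    then show ?case by (simp flip: exp_of_nat_mult)
  qed
  show "\<forall>\<^sub>F n in sequentially. exp (- (real (m n) * p n) / (1 - p n)) \<le> (1 - p n) ^ m n"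
    using lt
  proof eventually_elim
    case (elim n)
    have "1 / (1 - p n) = 1 + p n / (1 - p n)" using elim by (simp add: field_simps)
    also have "\<dots> \<le> exp (p n / (1 - p n))" by (rule exp_ge_add_one_self)
    finally have "exp (- (p n / (1 - p n))) \<le> 1 - p n"
      using elim by (simp add: exp_minus field_simps)
    then have "exp (- (p n / (1 - p n))) ^ m n \<le> (1 - p n) ^ m n"
      by (intro power_mono) auto
    then show ?case by (simp flip: exp_of_nat_mult)
  qed
  have "(\<lambda>n. exp (- (real (m n) * p n) / (1 - p n))) \<longlonglongrightarrow> exp (- \<beta> / (1 - 0))"
    by (intro tendsto_intros p mp) simp
  then show "(\<lambda>n. exp (- (real (m n) * p n) / (1 - p n))) \<longlonglongrightarrow> exp (- \<beta>)" by simp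
  show "(\<lambda>n. exp (- (real (m n) * p n))) \<longlonglongrightarrow> exp (- \<beta>)"
    by (intro tendsto_intros mp)
qed

text \<open>The probability that a Poisson variable of mean \<open>\<beta>\<close> is below
  \<open>j\<close>; the formula covers mean 0 through \<open>0 ^ 0 = 1\<close>.\<close>

definition poisson_below :: "real \<Rightarrow> nat \<Rightarrow> real" where
  "poisson_below \<beta> j = (\<Sum>i<j. \<beta> ^ i / fact i * exp (- \<beta>))"

text \<open>The Poisson limit theorem, term by term in the binomial sum.\<close>

lemma tail_prob_tendsto:
  fixes p :: "nat \<Rightarrow> real"
  assumes p: "p \<longlonglongrightarrow> 0" "\<And>n. 0 \<le> p n" and tp: "(\<lambda>n. real (t n) * p n) \<longlonglongrightarrow> \<beta>"
  shows "(\<lambda>n. 1 - tail_prob (p n) (t n) j) \<longlonglongrightarrow> poisson_below \<beta> j"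
  unfolding tail_prob_binomial poisson_below_def
proof (intro tendsto_sum tendsto_mult)
  fix i
  have shift: "(\<lambda>n. (real (t n) - real l) * p n) \<longlonglongrightarrow> \<beta>" for l
  proof -
    have "(\<lambda>n. real (t n) * p n - real l * p n) \<longlonglongrightarrow> \<beta> - real l * 0"
      by (intro tendsto_intros tp p)
    then show ?thesis by (simp add: left_diff_distrib)
  qed
  \<comment> \<open>The falling factorial has a fixed number of factors, each tending to
    \<open>\<beta>\<close> after multiplication by \<open>p n\<close>.\<close>
  have "real (t n choose i) * p n ^ i = (\<Prod>l<i. (real (t n) - real l) * p n) / fact i" for n
    by (simp add: binomial_gbinomial gbinomial_prod_rev prod.distrib lessThan_atLeast0)
  moreover have "(\<lambda>n. (\<Prod>l<i. (real (t n) - real l) * p n) / fact i) \<longlonglongrightarrow> (\<Prod>l<i. \<beta>) / fact i"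
    by (intro tendsto_intros shift) simp
  ultimately show "(\<lambda>n. real (t n choose i) * p n ^ i) \<longlonglongrightarrow> \<beta> ^ i / fact i" by simp
  have "(\<lambda>n. real (t n - i) * p n) \<longlonglongrightarrow> \<beta>"
  proof (rule tendsto_sandwich[OF _ _ shift[of i] tp])
    show "\<forall>\<^sub>F n in sequentially. (real (t n) - real i) * p n \<le> real (t n - i) * p n"
      using p(2) by (intro always_eventually allI mult_right_mono) linarith+
    show "\<forall>\<^sub>F n in sequentially. real (t n - i) * p n \<le> real (t n) * p n"
      using p(2) by (intro always_eventually allI mult_right_mono) auto
  qed
  then show "(\<lambda>n. (1 - p n) ^ (t n - i)) \<longlonglongrightarrow> exp (- \<beta>)"
    by (rule power_one_minus_tendsto_exp[OF p])
qed

text \<open>Right-continuity yields the strict inequality: a count below \<open>m\<close> at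
  \<open>\<beta>\<close> stays below \<open>m\<close> on an interval to the right, and monotonicity
  excludes earlier times.\<close>

lemma less_arrival_time_iff:
  assumes "0 \<le> \<beta>" and mono: "mono_on {0..} (\<lambda>t. N t \<omega>)"
    and cont: "continuous (at_right \<beta>) (\<lambda>s. N s \<omega>)"
  shows "ereal \<beta> < arrival_time N m \<omega> \<longleftrightarrow> N \<beta> \<omega> < m"
proof
  assume less: "ereal \<beta> < arrival_time N m \<omega>"
  show "N \<beta> \<omega> < m"
  proof (rule ccontr)
    assume "\<not> N \<beta> \<omega> < m"
    then have "arrival_time N m \<omega> \<le> ereal \<beta>"
      using assms(1) unfolding arrival_time_def by (intro Inf_lower) auto
    then show False using less by simp
  qed
next
  assume less: "N \<beta> \<omega> < m"
  have "((\<lambda>s. N s \<omega>) \<longlongrightarrow> N \<beta> \<omega>) (at_right \<beta>)"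
    using cont by (simp add: continuous_within)
  then have "\<forall>\<^sub>F s in at_right \<beta>. N s \<omega> < m"
    using less by (rule order_tendstoD)
  then obtain b where b: "\<beta> < b" "\<And>s. \<beta> < s \<Longrightarrow> s < b \<Longrightarrow> N s \<omega> < m"
    unfolding eventually_at_right_field by blast
  have "ereal b \<le> arrival_time N m \<omega>"
    unfolding arrival_time_def
  proof (intro Inf_greatest)
    fix z assume "z \<in> {ereal t |t. 0 \<le> t \<and> m \<le> N t \<omega>}"
    then obtain t where t: "z = ereal t" "0 \<le> t" "m \<le> N t \<omega>" by blast
    have "\<not> t \<le> \<beta>" using mono_onD[OF mono, of t \<beta>] t less assms(1) by auto
    then have "b \<le> t" using b(2)[of t] t(3) by force
    then show "ereal b \<le> z" using t(1) by simp
  qed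
  then show "ereal \<beta> < arrival_time N m \<omega>" using b(1) less_le_trans[of "ereal \<beta>" "ereal b"] by simp
qed

lemma prob_less_arrival_time:
  assumes N: "poisson_process P 1 N" and "0 \<le> \<beta>" "0 < m"
  shows "measure P {\<omega> \<in> space P. ereal \<beta> < arrival_time N m \<omega>} = poisson_below \<beta> m"
proof -
  interpret P: prob_space P using N by (simp add: poisson_process_def)
  have N0: "N 0 \<omega> = 0" if "\<omega> \<in> space P" for \<omega>
    using N that by (auto simp: poisson_process_def)
  have meas: "N t \<in> measurable P (count_space UNIV)" if "0 \<le> t" for t
    using N that by (auto simp: poisson_process_def)
  have "ereal \<beta> < arrival_time N m \<omega> \<longleftrightarrow> N \<beta> \<omega> < m" if "\<omega> \<in> space P" for \<omega>
    using N that assms(2) by (intro less_arrival_time_iff) (auto simp: poisson_process_def)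
  then have ev: "{\<omega> \<in> space P. ereal \<beta> < arrival_time N m \<omega>} = {\<omega> \<in> space P. N \<beta> \<omega> < m}"
    by blast
  show ?thesis
  proof (cases "\<beta> = 0")
    \<comment> \<open>The increment law is given only for \<open>s < t\<close>, so time 0 is handled
      through \<open>N 0 \<omega> = 0\<close>.\<close>
    case True
    have "{\<omega> \<in> space P. N \<beta> \<omega> < m} = space P" using N0 assms(3) True by auto
    moreover have "poisson_below 0 m = (\<Sum>i<m. if i = 0 then 1 else 0)"
      unfolding poisson_below_def by (intro sum.cong) auto
    ultimately show ?thesis using ev assms(3) True by (simp add: P.prob_space)
  next
    case False
    then have "0 < \<beta>" using assms(2) by simp
    have "{\<omega> \<in> space P. N \<beta> \<omega> < m} = (\<lambda>\<omega>. N \<beta> \<omega> - N 0 \<omega>) -` {..<m} \<inter> space P"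
      using N0 by auto
    moreover have "(\<lambda>\<omega>. N \<beta> \<omega> - N 0 \<omega>) \<in> measurable P (count_space UNIV)"
    proof (subst measurable_cong[where g = "N \<beta>"])
      show "N \<beta> \<in> measurable P (count_space UNIV)" using meas assms(2) .
    qed (simp add: N0)
    ultimately have "measure P {\<omega> \<in> space P. N \<beta> \<omega> < m} =
        measure (distr P (count_space UNIV) (\<lambda>\<omega>. N \<beta> \<omega> - N 0 \<omega>)) {..<m}"
      by (simp add: measure_distr)
    also have "distr P (count_space UNIV) (\<lambda>\<omega>. N \<beta> \<omega> - N 0 \<omega>) = measure_pmf (poisson_pmf (1 * (\<beta> - 0)))"
      using N \<open>0 < \<beta>\<close> unfolding poisson_process_def by blast
    also have "measure (measure_pmf (poisson_pmf (1 * (\<beta> - 0)))) {..<m} = poisson_below \<beta> m"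
      using \<open>0 < \<beta>\<close> by (simp add: measure_measure_pmf_finite poisson_below_def)
    finally show ?thesis by (simp add: ev)
  qed
qed


section \<open>Asymptotics of the block size\<close>

lemma powr_neg_tendsto_0: "s < 0 \<Longrightarrow> (\<lambda>n. real n powr s) \<longlonglongrightarrow> 0"
  by (rule tendsto_neg_powr[OF _ filterlim_real_sequentially])

locale block_size =
  fixes \<delta> :: real and k :: "nat \<Rightarrow> nat"
  assumes \<delta>: "0 < \<delta>" "\<delta> < 1" and k: "\<And>n. k n = nat \<lfloor>real n powr \<delta>\<rfloor>"
begin

lemma k_le: "real (k n) \<le> real n powr \<delta>"
  by (simp add: k)

lemma powr_ge: "\<forall>\<^sub>F n in sequentially. c \<le> real n powr \<delta>"
  using eventually_ge_at_top[of "nat \<lceil>max c 1 powr (1 / \<delta>)\<rceil>"]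
proof eventually_elim
  case (elim n)
  then have "max c 1 powr (1 / \<delta>) \<le> real n" by linarith
  then have "(max c 1 powr (1 / \<delta>)) powr \<delta> \<le> real n powr \<delta>"
    using \<delta> by (intro powr_mono2) auto
  then show ?case using \<delta> by (simp add: powr_powr)
qed

text \<open>The floor loses at most 1, which is at most half of \<open>real n powr \<delta>\<close>
  once that is at least 2.\<close>

lemma k_ge: "\<forall>\<^sub>F n in sequentially. real n powr \<delta> / 2 \<le> real (k n)"
  using powr_ge[of 2]
proof eventually_elim
  case (elim n)
  have "real n powr \<delta> - 1 \<le> real (k n)"
    unfolding k by linarith
  then show ?case using elim by linarith
qed

lemma two_le_k: "\<forall>\<^sub>F n in sequentially. 2 \<le> k n"
  using powr_ge[of 2]
  by eventually_elim (simp add: k le_nat_iff le_floor_iff)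

lemma k_le_n: "k n \<le> n"
proof (cases "n = 0")
  case False
  then have "real n powr \<delta> \<le> real n powr 1" using \<delta> by (intro powr_mono) auto
  then have "real (k n) \<le> real n" using k_le[of n] False by simp
  then show ?thesis by simp
qed (simp add: k)

lemma power_over_tendsto_0:
  assumes "real m * \<delta> < 1"
  shows "(\<lambda>n. real (k n) ^ m / real n) \<longlonglongrightarrow> 0"
proof (rule tendsto_sandwich[OF _ _ tendsto_const powr_neg_tendsto_0])
  show "real m * \<delta> - 1 < 0" using assms by simp
  show "\<forall>\<^sub>F n in sequentially. 0 \<le> real (k n) ^ m / real n" by simp
  show "\<forall>\<^sub>F n in sequentially. real (k n) ^ m / real n \<le> real n powr (real m * \<delta> - 1)"
    using eventually_gt_at_top[of 0]
  proof eventually_elim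
    case (elim n)
    have "real (k n) ^ m \<le> (real n powr \<delta>) ^ m" by (intro power_mono k_le) simp
    also have "\<dots> = real n powr (real m * \<delta>)"
      using elim by (simp add: powr_powr mult.commute flip: powr_realpow)
    finally have "real (k n) ^ m / real n \<le> real n powr (real m * \<delta>) / real n"
      by (intro divide_right_mono) auto
    then show ?case using elim by (simp add: powr_diff)
  qed
qed

text \<open>The lower bound \<open>k_ge\<close> costs the factor \<open>2 ^ m\<close>. The exponent
  \<open>s\<close> is 0 for \<open>1 / k\<close> and 1 for \<open>n / k ^ m\<close>.\<close>

lemma over_power_tendsto_0:
  assumes "s < real m * \<delta>"
  shows "(\<lambda>n. real n powr s / real (k n) ^ m) \<longlonglongrightarrow> 0"
proof (rule tendsto_sandwich[OF _ _ tendsto_const])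
  have "(\<lambda>n. 2 ^ m * real n powr (s - real m * \<delta>)) \<longlonglongrightarrow> 2 ^ m * 0"
    using assms by (intro tendsto_intros powr_neg_tendsto_0) simp
  then show "(\<lambda>n. 2 ^ m * real n powr (s - real m * \<delta>)) \<longlonglongrightarrow> 0" by simp
  show "\<forall>\<^sub>F n in sequentially. 0 \<le> real n powr s / real (k n) ^ m" by simp
  show "\<forall>\<^sub>F n in sequentially. real n powr s / real (k n) ^ m \<le> 2 ^ m * real n powr (s - real m * \<delta>)"
    using eventually_gt_at_top[of 0] k_ge
  proof eventually_elim
    case (elim n)
    have "(real n powr \<delta> / 2) ^ m \<le> real (k n) ^ m"
      using elim(2) by (intro power_mono) auto
    moreover have "(real n powr \<delta> / 2) ^ m = real n powr (real m * \<delta>) / 2 ^ m"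
      using elim by (simp add: power_divide powr_powr mult.commute flip: powr_realpow)
    moreover have "0 < real n powr (real m * \<delta>) / 2 ^ m" using elim(1) by simp
    moreover from calculation have "0 < real (k n) ^ m" by linarith
    ultimately have "real n powr s / real (k n) ^ m \<le> real n powr s / (real n powr (real m * \<delta>) / 2 ^ m)"
      by (intro divide_left_mono mult_pos_pos powr_ge_zero) linarith+
    then show ?case by (simp add: powr_diff mult.commute)
  qed
qed

lemma rate_tendsto_0: "(\<lambda>n. real (k n) / real n) \<longlonglongrightarrow> 0"
  using power_over_tendsto_0[of 1] \<delta> by simp

lemma inverse_tendsto_0: "(\<lambda>n. 1 / real (k n)) \<longlonglongrightarrow> 0"
proof (rule Lim_transform_eventually)
  show "(\<lambda>n. real n powr 0 / real (k n) ^ 1) \<longlonglongrightarrow> 0"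
    using \<delta> by (intro over_power_tendsto_0) simp
  show "\<forall>\<^sub>F n in sequentially. real n powr 0 / real (k n) ^ 1 = 1 / real (k n)"
    using eventually_gt_at_top[of 0] by eventually_elim simp
qed

lemma ratio_tendsto_0:
  assumes "1 < real m * \<delta>"
  shows "(\<lambda>n. real n / real (k n) ^ m) \<longlonglongrightarrow> 0"
  using over_power_tendsto_0[OF assms] by simp

end

text \<open>Eliminating \<open>t\<close> through \<open>t \<le> \<beta> * n / k\<close> leaves
  \<open>1 / k\<close>, \<open>n / k ^ (j + 2)\<close> and \<open>k ^ (j + 1) / n\<close>, all of
  which vanish for \<open>k\<close> of order \<open>n powr \<delta>\<close> with
  \<open>(j + 1) * \<delta> < 1 < (j + 2) * \<delta>\<close>.\<close>

lemma error_bound_le: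
  assumes kn: "0 < k" "0 < n" and \<beta>: "0 \<le> \<beta>" and t: "real t * (real k / real n) \<le> \<beta>"
  shows "error_bound n k \<beta> t j \<le> sqrt (\<beta> * (1 / real k))
    + sqrt (\<beta>\<^sup>2 * energy_const \<beta> j * (real n / real k ^ Suc (Suc j) + 1 / real k))
    + light_const \<beta> (Suc j) * (real k ^ Suc j / real n)"
proof -
  have t': "real t \<le> \<beta> * (real n / real k)" using t kn by (simp add: field_simps)
  have "real t / real n \<le> \<beta> * (1 / real k)" using t' kn by (simp add: field_simps)
  moreover have "real t * sqrt (real k / real n * (energy_const \<beta> j * (1 / real k ^ Suc j + 1 / real n))) \<le>
      sqrt (\<beta>\<^sup>2 * energy_const \<beta> j * (real n / real k ^ Suc (Suc j) + 1 / real k))"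
  \<comment> \<open>With \<open>t\<close> moved inside the root, \<open>t\<^sup>2 * (k / n)\<close>
    is at most \<open>\<beta>\<^sup>2 * (n / k)\<close>.\<close>
  proof (rule real_le_rsqrt)
    define e where "e = energy_const \<beta> j * (1 / real k ^ Suc j + 1 / real n)"
    have e0: "0 \<le> e" using energy_const_nonneg[OF \<beta>] by (simp add: e_def)
    have "(real t * sqrt (real k / real n * e))\<^sup>2 = (real t)\<^sup>2 * (real k / real n * e)"
      using e0 by (simp add: power_mult_distrib)
    also have "\<dots> \<le> (\<beta> * (real n / real k))\<^sup>2 * (real k / real n * e)"
      using t' e0 by (intro mult_right_mono power_mono) auto
    also have "\<dots> = \<beta>\<^sup>2 * (real n / real k) * e"
      using kn by (simp add: power2_eq_square)
    also have "\<dots> = \<beta>\<^sup>2 * energy_const \<beta> j * (real n / real k ^ Suc (Suc j) + 1 / real k)"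
      using kn by (simp add: e_def field_simps)
    finally show "(real t * sqrt (real k / real n * (energy_const \<beta> j * (1 / real k ^ Suc j + 1 / real n))))\<^sup>2 \<le>
        \<beta>\<^sup>2 * energy_const \<beta> j * (real n / real k ^ Suc (Suc j) + 1 / real k)"
      by (simp only: e_def)
  qed
  ultimately show ?thesis
    unfolding error_bound_def by (intro add_mono real_sqrt_le_mono) auto
qed

section \<open>Convergence in probability of the distance after the first hit\<close>

theorem theorem2p13:
  fixes \<delta> \<beta> :: real
    and k t_bar x\<^sub>0 :: "nat \<Rightarrow> nat"
    and M :: "nat \<Rightarrow> 'a measure"
    and A :: "nat \<Rightarrow> nat \<Rightarrow> 'a \<Rightarrow> nat set"
    and P :: "'b measure"
    and N :: "real \<Rightarrow> 'b \<Rightarrow> nat"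
  assumes "0 < \<delta>" and "\<delta> < 1" and "1 / \<delta> \<notin> \<nat>"
    and "0 \<le> \<beta>"
    and "\<And>n. k n = nat \<lfloor>real n powr \<delta>\<rfloor>"
    and "\<And>n. t_bar n = nat \<lfloor>\<beta> * real n / real (k n)\<rfloor>"
    and "\<And>n. 2 \<le> k n \<Longrightarrow> x\<^sub>0 n \<in> sites n"
    and "\<And>n. 2 \<le> k n \<Longrightarrow> iid_uniform_blocks (M n) n (k n) (A n)"
    and "poisson_process P 1 N"
  shows "tendsto_in_probability M
           (\<lambda>n \<omega>. tv_dist n (x\<^sub>0 n) (\<lambda>t. A n t \<omega>)
                     (start_time (x\<^sub>0 n) (\<lambda>t. A n t \<omega>) + t_bar n))
           (measure P {\<omega> \<in> space P. ereal \<beta> < arrival_time N (nat \<lfloor>1 / \<delta>\<rfloor>) \<omega>})"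
proof -
  interpret block_size \<delta> k
    using assms(1,2,5) by unfold_locales
  define m where "m = nat \<lfloor>1 / \<delta>\<rfloor>"
  have "1 \<le> \<lfloor>1 / \<delta>\<rfloor>" using assms(1,2) by (simp add: le_floor_iff)
  then have m: "0 < m" "real m = of_int \<lfloor>1 / \<delta>\<rfloor>" unfolding m_def by linarith+
  then obtain j where j: "m = Suc j" using gr0_implies_Suc by blast
  \<comment> \<open>Since \<open>1 / \<delta>\<close> is not an integer,
    \<open>m * \<delta> < 1\<close> is strict, which makes light sites negligible; the floor gives
    \<open>1 < (m + 1) * \<delta>\<close>, which makes the excess vanish.\<close>
  have "real m \<noteq> 1 / \<delta>" using assms(3) by (metis of_nat_in_Nats)
  moreover have "real m \<le> 1 / \<delta>" "1 / \<delta> < real m + 1" unfolding m(2) by linarith+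
  ultimately have m_bounds: "real (Suc j) * \<delta> < 1" "1 < real (Suc (Suc j)) * \<delta>"
    using assms(1) by (auto simp: j field_simps)
  have c: "measure P {\<omega> \<in> space P. ereal \<beta> < arrival_time N (nat \<lfloor>1 / \<delta>\<rfloor>) \<omega>} = poisson_below \<beta> m"
    unfolding m_def[symmetric] by (rule prob_less_arrival_time[OF assms(9,4) m(1)])
  let ?rate = "\<lambda>n. real (k n) / real n"
  have t_upper: "real (t_bar n) * ?rate n \<le> \<beta>" for n
  proof -
    have "real (t_bar n) \<le> \<beta> * real n / real (k n)"
      using assms(4) by (simp add: assms(6))
    then have "real (t_bar n) * ?rate n \<le> \<beta> * real n / real (k n) * ?rate n"
      by (intro mult_right_mono) auto
    also have "\<dots> \<le> \<beta>" using assms(4) by simp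
    finally show ?thesis .
  qed
  have t_lim: "(\<lambda>n. real (t_bar n) * ?rate n) \<longlonglongrightarrow> \<beta>"
  proof (rule tendsto_sandwich)
    have "(\<lambda>n. \<beta> - ?rate n) \<longlonglongrightarrow> \<beta> - 0" by (intro tendsto_intros rate_tendsto_0)
    then show "(\<lambda>n. \<beta> - ?rate n) \<longlonglongrightarrow> \<beta>" by simp
    show "\<forall>\<^sub>F n in sequentially. \<beta> - ?rate n \<le> real (t_bar n) * ?rate n"
      using two_le_k eventually_gt_at_top[of 0]
    proof eventually_elim
      case (elim n)
      \<comment> \<open>The floor loses at most 1, which after multiplication costs at most the
        vanishing \<open>?rate n\<close>.\<close>
      have "\<beta> * real n / real (k n) - 1 \<le> real (t_bar n)" unfolding assms(6) by linarith
      then have "(\<beta> * real n / real (k n) - 1) * ?rate n \<le> real (t_bar n) * ?rate n"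
        by (intro mult_right_mono) auto
      then show ?case using elim by (simp add: left_diff_distrib diff_divide_distrib)
    qed
  qed (use t_upper in auto)
  have err: "(\<lambda>n. sqrt (\<beta> * (1 / real (k n)))
      + sqrt (\<beta>\<^sup>2 * energy_const \<beta> j * (real n / real (k n) ^ Suc (Suc j) + 1 / real (k n)))
      + light_const \<beta> (Suc j) * (real (k n) ^ Suc j / real n)) \<longlonglongrightarrow>
      sqrt (\<beta> * 0) + sqrt (\<beta>\<^sup>2 * energy_const \<beta> j * (0 + 0)) + light_const \<beta> (Suc j) * 0"
    by (intro tendsto_intros inverse_tendsto_0 ratio_tendsto_0 power_over_tendsto_0 m_bounds)
  define err where "err n = sqrt (\<beta> * (1 / real (k n)))
      + sqrt (\<beta>\<^sup>2 * energy_const \<beta> j * (real n / real (k n) ^ Suc (Suc j) + 1 / real (k n)))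
      + light_const \<beta> (Suc j) * (real (k n) ^ Suc j / real n)" for n
  have err_lim: "err \<longlonglongrightarrow> 0" using err by (simp add: err_def[abs_def])
  have tail: "(\<lambda>n. 1 - tail_prob (?rate n) (t_bar n) (Suc j)) \<longlonglongrightarrow> poisson_below \<beta> m"
    unfolding j by (intro tail_prob_tendsto rate_tendsto_0 t_lim) auto
  have iid: "iid_sampling n (k n) (M n) (A n) (x\<^sub>0 n)" if "2 \<le> k n" for n
    using that assms(7,8)[of n] k_le_n[of n] by unfold_locales auto
  show ?thesis
    unfolding tendsto_in_probability_def c
  proof (intro conjI allI impI)
    show "\<forall>\<^sub>F n in sequentially. (\<lambda>\<omega>. tv_dist n (x\<^sub>0 n) (\<lambda>t. A n t \<omega>)
        (start_time (x\<^sub>0 n) (\<lambda>t. A n t \<omega>) + t_bar n)) \<in> borel_measurable (M n)"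
      using two_le_k by eventually_elim (rule iid_sampling.stopped_tv_dist_measurable[OF iid])
  next
    fix \<epsilon> :: real assume \<epsilon>: "0 < \<epsilon>"
    show "(\<lambda>n. measure (M n) {\<omega> \<in> space (M n). \<epsilon> < \<bar>tv_dist n (x\<^sub>0 n) (\<lambda>t. A n t \<omega>)
        (start_time (x\<^sub>0 n) (\<lambda>t. A n t \<omega>) + t_bar n) - poisson_below \<beta> m\<bar>}) \<longlonglongrightarrow> 0"
    proof (rule tendsto_sandwich[OF _ _ tendsto_const])
      have "(\<lambda>n. err n / (\<epsilon> / 2)) \<longlonglongrightarrow> 0 / (\<epsilon> / 2)"
        using \<epsilon> by (intro tendsto_intros err_lim) simp
      then show "(\<lambda>n. err n / (\<epsilon> / 2)) \<longlonglongrightarrow> 0" by simp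
      \<comment> \<open>The binomial probability is eventually within \<open>\<epsilon> / 2\<close>
        of its Poisson limit, as \<open>tv_deviation\<close> requires.\<close>
      have close: "\<forall>\<^sub>F n in sequentially.
          \<bar>(1 - tail_prob (?rate n) (t_bar n) (Suc j)) - poisson_below \<beta> m\<bar> < \<epsilon> / 2"
        using tendstoD[OF tail, of "\<epsilon> / 2"] \<epsilon> by (simp add: dist_real_def)
      show "\<forall>\<^sub>F n in sequentially. measure (M n) {\<omega> \<in> space (M n).
          \<epsilon> < \<bar>tv_dist n (x\<^sub>0 n) (\<lambda>t. A n t \<omega>)
            (start_time (x\<^sub>0 n) (\<lambda>t. A n t \<omega>) + t_bar n) - poisson_below \<beta> m\<bar>} \<le> err n / (\<epsilon> / 2)"
        using two_le_k close
      proof eventually_elim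
        case (elim n)
        interpret iid_sampling n "k n" "M n" "A n" "x\<^sub>0 n"
          using elim(1) by (rule iid)
        show ?case
        proof (rule stopped_prob_le)
          fix S assume "S \<in> blocks n (k n)"
          then interpret started_sampling n "k n" S by unfold_locales
          have "mean (block_seqs (t_bar n)) (\<lambda>l. of_bool (\<epsilon> < \<bar>tv l - poisson_below \<beta> m\<bar>))
              \<le> error_bound n (k n) \<beta> (t_bar n) j / (\<epsilon> / 2)"
            using elim(2) by (intro tv_deviation assms(4) t_upper \<epsilon>) auto
          also have "\<dots> \<le> err n / (\<epsilon> / 2)"
            unfolding err_def using \<epsilon> by (intro divide_right_mono error_bound_le assms(4) t_upper) auto
          finally show "mean (block_seqs (t_bar n)) (\<lambda>l. of_bool (\<epsilon> < \<bar>tv l - poisson_below \<beta> m\<bar>))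
              \<le> err n / (\<epsilon> / 2)" .
        qed
      qed
    qed (simp add: always_eventually)
  qed
qed

end
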